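(* Let $\mathcal{G}$ be a propagating graph of bounded degree, $V:\mathcal{V}(\mathcal{G})\to\mathbb{R}$ a periodic potential, $H=H_{\mathcal{G},V}$ the associated Schr\"odinger operator, $\tilde\sigma$ its density of states measure and $\gamma(E)$ its growth rate. Then for every $E\in\mathbb{C}$ with $\mathrm{Im}(E)\neq0$, $$\int_{\mathbb{R}}\log|E'-E|\,d\tilde\sigma(E')=\gamma(E).$$
   Context: $H_{\mathcal{G},V}$ acts on $\ell^2(\mathcal{V}(\mathcal{G}))$ by $(H_{\mathcal{G},V}\phi)(v)=\sum_{v'\sim v}[\phi(v')-\phi(v)]+V(v)\phi(v)$. A graph $\mathcal{G}$ is propagating if: there is a graph automorphism $f$ of $\mathcal{G}$ generating a free $\mathbb{Z}$-action on $\mathcal{V}(\mathcal{G})$ with finitely many orbits, and a partial order $\le$ on $\mathcal{V}(\mathcal{G})$ for which $f$ is a strictly increasing order automorphism ($v<f(v)$), such that $f(v)$ and $v$ are adjacent for every $v$, and every neighbour $w$ of $v$ satisfies $f^{-1}(v)\le w\le f(v)$. $V$ is periodic if it is $f^p$-invariant for some integer $p\ge1$. The density of states measure $\tilde\sigma$ is the average of the spectral measures $\sigma_{V,v}$ ($\langle\delta_v,g(H)\delta_v\rangle=\int g\,d\sigma_{V,v}$) over one representative $v$ of each orbit of $f^p$. Growth rate. The partial order is extended to a total order on $\mathcal{V}(\mathcal{G})$ for which $f$ is still an order automorphism and $\mathcal{G}$ is still propagating, and $\mathcal{V}(\mathcal{G})$ is then identified, as an ordered set, with $\mathbb{Z}$.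 If $r$ is the number of orbits of $f$, then $f$ becomes $n\mapsto n+r$, all neighbours of $n$ lie in $[n-r,n+r]$, and $(Hu)(n)=\widehat V(n)u(n)+\sum_{i=-r}^{r}A_{n,n+i}u(n+i)$, where $A$ is the adjacency matrix (so $A_{n,n\pm r}=1$, $A_{n,n}=0$) and $\widehat V(n)=V(n)-\deg(n)$. For $E\in\mathbb{C}$, formal solutions $u:\mathbb{Z}\to\mathbb{C}$ of $Hu=Eu$ satisfy $u(n+2r)=(E-\widehat V(n+r))u(n+r)-\sum_{i=-r}^{r-1}A_{n+r,n+r+i}u(n+r+i)$. Let $A_n(E)$ be the $2r\times2r$ transfer matrix mapping $(u(n),\dots,u(n+2r-1))^t$ to $(u(n+1),\dots,u(n+2r))^t$, and $T_n(E)=A_n(E)\cdots A_1(E)$. The Lyapunov exponents $\gamma_1(E)\ge\dots\ge\gamma_{2r}(E)$ are defined by $\gamma_1(E)+\dots+\gamma_k(E)=\lim_{n\to\infty}\frac1n\log\|\bigwedge^kT_n(E)\|$ (the limit exists since $n\mapsto A_n(E)$ is periodic), and the growth rate is $\gamma(E)=\gamma_1(E)+\dots+\gamma_r(E)$. *)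

theory Defs
  imports "HOL-Analysis.Analysis" "Jordan_Normal_Form.Determinant"
    "Jordan_Normal_Form.DL_Submatrix"
begin

section \<open>The Hilbert space of square-summable functions\<close>

typedef 'v ell2 = "{\<phi> :: 'v \<Rightarrow> complex. (\<lambda>v. (cmod (\<phi> v))\<^sup>2) summable_on UNIV}"
  morphisms ell2_apply Abs_ell2
  by (intro exI[of _ "\<lambda>_. 0"]) simp

setup_lifting type_definition_ell2

lemma ell2_apply_summable: "(\<lambda>v. (cmod (ell2_apply \<phi> v))\<^sup>2) summable_on UNIV"
  using ell2_apply[of \<phi>] by simp

lemma square_summable_prod:
  fixes f g :: "'v \<Rightarrow> complex"
  assumes "(\<lambda>v. (cmod (f v))\<^sup>2) summable_on A" "(\<lambda>v. (cmod (g v))\<^sup>2) summable_on A"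
  shows "(\<lambda>v. cnj (f v) * g v) summable_on A"
proof (rule abs_summable_summable, rule Infinite_Sum.abs_summable_on_comparison_test')
  show "(\<lambda>v. (cmod (f v))\<^sup>2 + (cmod (g v))\<^sup>2) summable_on A"
    using assms by (rule summable_on_add)
  fix v assume "v \<in> A"
  have "2 * (cmod (f v) * cmod (g v)) \<le> (cmod (f v))\<^sup>2 + (cmod (g v))\<^sup>2"
    using zero_le_power2[of "cmod (f v) - cmod (g v)"] by (simp add: power2_diff)
  moreover have "0 \<le> cmod (f v) * cmod (g v)" by simp
  ultimately show "cmod (cnj (f v) * g v) \<le> (cmod (f v))\<^sup>2 + (cmod (g v))\<^sup>2"
    unfolding norm_mult complex_mod_cnj by linarith
qed

lemma square_summable_add:
  fixes f g :: "'v \<Rightarrow> complex"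
  assumes "(\<lambda>v. (cmod (f v))\<^sup>2) summable_on A" "(\<lambda>v. (cmod (g v))\<^sup>2) summable_on A"
  shows "(\<lambda>v. (cmod (f v + g v))\<^sup>2) summable_on A"
proof (rule summable_on_comparison_test)
  show "(\<lambda>v. 2 * ((cmod (f v))\<^sup>2 + (cmod (g v))\<^sup>2)) summable_on A"
    using assms by (intro summable_on_cmult_right summable_on_add)
  fix v assume "v \<in> A"
  have "(cmod (f v + g v))\<^sup>2 \<le> (cmod (f v) + cmod (g v))\<^sup>2"
    by (intro power_mono norm_triangle_ineq) simp
  also have "\<dots> \<le> 2 * ((cmod (f v))\<^sup>2 + (cmod (g v))\<^sup>2)"
    using zero_le_power2[of "cmod (f v) - cmod (g v)"] by (simp add: power2_sum power2_diff)
  finally show "(cmod (f v + g v))\<^sup>2 \<le> 2 * ((cmod (f v))\<^sup>2 + (cmod (g v))\<^sup>2)" .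
qed simp

lemma square_summable_mult:
  fixes f :: "'v \<Rightarrow> complex"
  assumes "(\<lambda>v. (cmod (f v))\<^sup>2) summable_on A"
  shows "(\<lambda>v. (cmod (c * f v))\<^sup>2) summable_on A"
  using summable_on_cmult_right[OF assms, of "(cmod c)\<^sup>2"]
  by (simp add: norm_mult power_mult_distrib)

definition ell2_cinner :: "'v ell2 \<Rightarrow> 'v ell2 \<Rightarrow> complex" where
  "ell2_cinner \<phi> \<psi> = (\<Sum>\<^sub>\<infinity>v. cnj (ell2_apply \<phi> v) * ell2_apply \<psi> v)"

instantiation ell2 :: (type) real_inner
begin

lift_definition zero_ell2 :: "'v ell2" is "\<lambda>_. 0" by simp

lift_definition plus_ell2 :: "'v ell2 \<Rightarrow> 'v ell2 \<Rightarrow> 'v ell2" is "\<lambda>\<phi> \<psi> v. \<phi> v + \<psi> v"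
  by (simp add: square_summable_add)

lift_definition uminus_ell2 :: "'v ell2 \<Rightarrow> 'v ell2" is "\<lambda>\<phi> v. - \<phi> v" by simp

lift_definition minus_ell2 :: "'v ell2 \<Rightarrow> 'v ell2 \<Rightarrow> 'v ell2" is "\<lambda>\<phi> \<psi> v. \<phi> v - \<psi> v"
  subgoal for \<phi> \<psi> using square_summable_add[of \<phi> UNIV "\<lambda>v. - \<psi> v"] by simp
  done

lift_definition scaleR_ell2 :: "real \<Rightarrow> 'v ell2 \<Rightarrow> 'v ell2" is "\<lambda>a \<phi> v. of_real a * \<phi> v"
  by (simp only: mem_Collect_eq square_summable_mult)

definition "inner_ell2 (\<phi> :: 'v ell2) \<psi> = Re (ell2_cinner \<phi> \<psi>)"
definition "norm_ell2 (\<phi> :: 'v ell2) = sqrt (inner \<phi> \<phi>)"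
definition "sgn_ell2 (\<phi> :: 'v ell2) = inverse (norm \<phi>) *\<^sub>R \<phi>"
definition "dist_ell2 (\<phi> :: 'v ell2) \<psi> = norm (\<phi> - \<psi>)"
definition [code del]:
  "(uniformity_ell2 :: ('v ell2 \<times> 'v ell2) filter) = (INF e\<in>{0<..}. principal {(x, y). dist x y < e})"
definition [code del]:
  "open_ell2 (U :: 'v ell2 set) \<longleftrightarrow> (\<forall>x\<in>U. eventually (\<lambda>(x', y). x' = x \<longrightarrow> y \<in> U) uniformity)"

instance
proof
  fix x y z :: "'v ell2" and a b :: real
  show "x + y + z = x + (y + z)" by transfer (simp add: algebra_simps)
  show "x + y = y + x" by transfer (simp add: algebra_simps)
  show "0 + x = x" by transfer simp
  show "- x + x = 0" by transfer simp
  show "x - y = x + - y" by transfer simp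
  show "a *\<^sub>R (x + y) = a *\<^sub>R x + a *\<^sub>R y" by transfer (simp add: algebra_simps)
  show "(a + b) *\<^sub>R x = a *\<^sub>R x + b *\<^sub>R x" by transfer (simp add: algebra_simps)
  show "a *\<^sub>R b *\<^sub>R x = (a * b) *\<^sub>R x" by transfer (simp add: algebra_simps)
  show "1 *\<^sub>R x = x" by transfer simp
  show "sgn x = inverse (norm x) *\<^sub>R x" by (rule sgn_ell2_def)
  show "dist x y = norm (x - y)" by (rule dist_ell2_def)
  show "(uniformity :: ('v ell2 \<times> 'v ell2) filter) = (INF e\<in>{0<..}. principal {(x, y). dist x y < e})"
    by (rule uniformity_ell2_def)
  show "open U \<longleftrightarrow> (\<forall>x\<in>U. \<forall>\<^sub>F (x', y) in uniformity. x' = x \<longrightarrow> y \<in> U)" for U :: "'v ell2 set"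
    by (rule open_ell2_def)
  note summ = square_summable_prod[OF ell2_apply_summable ell2_apply_summable]
  have cnj_inner: "ell2_cinner y x = cnj (ell2_cinner x y)"
    unfolding ell2_cinner_def infsum_cnj[symmetric] by (simp add: mult.commute)
  show "inner x y = inner y x"
    unfolding inner_ell2_def by (subst cnj_inner) simp
  show "inner (x + y) z = inner x z + inner y z"
    by (simp add: inner_ell2_def ell2_cinner_def plus_ell2.rep_eq ring_distribs
        infsum_add[OF summ summ])
  show "inner (a *\<^sub>R x) y = a * inner x y"
    by (simp add: inner_ell2_def ell2_cinner_def scaleR_ell2.rep_eq mult.assoc
        infsum_cmult_right[OF summ])
  have sq: "inner x x = (\<Sum>\<^sub>\<infinity>v. (cmod (ell2_apply x v))\<^sup>2)"
    unfolding inner_ell2_def ell2_cinner_def infsum_Re[OF summ, symmetric]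
    by (intro infsum_cong) (simp add: cmod_def flip: power2_eq_square)
  show "0 \<le> inner x x"
    unfolding sq by (simp add: infsum_nonneg)
  show "inner x x = 0 \<longleftrightarrow> x = 0"
  proof
    assume "inner x x = 0"
    then have "(\<Sum>\<^sub>\<infinity>v. (cmod (ell2_apply x v))\<^sup>2) = 0"
      unfolding sq .
    then have "(cmod (ell2_apply x v))\<^sup>2 = 0" for v
      using nonneg_infsum_le_0D[OF _ ell2_apply_summable[of x], of v] by simp
    then show "x = 0" by transfer auto
  next
    assume "x = 0" then show "inner x x = 0"
      by (simp add: inner_ell2_def ell2_cinner_def zero_ell2.rep_eq)
  qed
  show "norm x = sqrt (inner x x)" by (rule norm_ell2_def)
qed

end

lift_definition ell2_delta :: "'v \<Rightarrow> 'v ell2" is "\<lambda>v w. of_bool (w = v)"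
  subgoal for v
    using summable_on_cong_neutral[of UNIV "{v}" "\<lambda>w. (cmod (of_bool (w = v)))\<^sup>2"
        "\<lambda>w. (cmod (of_bool (w = v)))\<^sup>2"]
    by simp
  done

section \<open>Schroedinger operators on graphs\<close>

text \<open>
  A graph is given by a symmetric irreflexive adjacency relation on the type of its vertices.
\<close>

definition simple_graph :: "('v \<Rightarrow> 'v \<Rightarrow> bool) \<Rightarrow> bool" where
  "simple_graph adj \<longleftrightarrow> symp adj \<and> irreflp adj"

definition bounded_degree :: "('v \<Rightarrow> 'v \<Rightarrow> bool) \<Rightarrow> bool" where
  "bounded_degree adj \<longleftrightarrow> (\<exists>d. \<forall>v. finite {w. adj v w} \<and> card {w. adj v w} \<le> d)"

definition schrodinger_fun ::
    "('v \<Rightarrow> 'v \<Rightarrow> bool) \<Rightarrow> ('v \<Rightarrow> real) \<Rightarrow> ('v \<Rightarrow> complex) \<Rightarrow> 'v \<Rightarrow> complex" where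
  "schrodinger_fun adj V \<phi> v = (\<Sum>w | adj v w. \<phi> w - \<phi> v) + of_real (V v) * \<phi> v"

definition schrodinger ::
    "('v \<Rightarrow> 'v \<Rightarrow> bool) \<Rightarrow> ('v \<Rightarrow> real) \<Rightarrow> 'v ell2 \<Rightarrow>\<^sub>L 'v ell2" where
  "schrodinger adj V = Blinfun (\<lambda>\<phi>. Abs_ell2 (schrodinger_fun adj V (ell2_apply \<phi>)))"

text \<open>
  \<open>Blinfun\<close> and \<open>Abs_ell2\<close> are total; for bounded degree and bounded \<open>V\<close>, in particular for
  potentials that are invariant under an action with finitely many orbits, they are applied above
  to a bounded linear map and to square-summable functions.
\<close>

lemma schrodinger_fun_square_sum:
  fixes adj :: "'v \<Rightarrow> 'v \<Rightarrow> bool" and \<phi> :: "'v \<Rightarrow> complex"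
  assumes sg: "simple_graph adj"
    and deg: "\<And>v. finite {w. adj v w} \<and> card {w. adj v w} \<le> d"
    and V: "\<And>v. \<bar>V v\<bar> \<le> c"
    and \<phi>: "(\<lambda>v. (cmod (\<phi> v))\<^sup>2) summable_on UNIV"
    and F: "finite F"
  shows "(\<Sum>v\<in>F. (cmod (schrodinger_fun adj V \<phi> v))\<^sup>2)
    \<le> (2 * (real d)\<^sup>2 + 2 * (c + real d)\<^sup>2) * (\<Sum>\<^sub>\<infinity>v. (cmod (\<phi> v))\<^sup>2)"
proof -
  define a where "a v = (cmod (\<phi> v))\<^sup>2" for v
  define N where "N v = {w. adj v w}" for v
  have a0: "a v \<ge> 0" for v by (simp add: a_def)
  have finN: "finite (N v)" and cardN: "card (N v) \<le> d" for v using deg by (auto simp: N_def)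
  have symN: "w \<in> N v \<longleftrightarrow> v \<in> N w" for v w
    using sg by (auto simp: N_def simple_graph_def dest: sympD)
  have asum: "sum a G \<le> infsum a UNIV" if "finite G" for G
    using \<phi> that a0 by (intro finite_sum_le_infsum) (auto simp: a_def[abs_def])
  have c0: "c \<ge> 0" using V[of undefined] by linarith
  have pt: "(cmod (schrodinger_fun adj V \<phi> v))\<^sup>2
      \<le> 2 * (real d * (\<Sum>w\<in>N v. a w)) + 2 * ((c + real d)\<^sup>2 * a v)" for v
  proof -
    define x where "x = (\<Sum>w\<in>N v. cmod (\<phi> w))"
    define y where "y = (c + real d) * cmod (\<phi> v)"
    have eq: "schrodinger_fun adj V \<phi> v
        = (\<Sum>w\<in>N v. \<phi> w) + of_real (V v - real (card (N v))) * \<phi> v"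
      by (simp add: schrodinger_fun_def N_def sum_subtractf algebra_simps)
    have "\<bar>V v - real (card (N v))\<bar> \<le> c + real d"
      using V[of v] cardN[of v] by linarith
    then have "cmod (of_real (V v - real (card (N v))) * \<phi> v) \<le> y"
      unfolding norm_mult norm_of_real y_def by (rule mult_right_mono) simp
    then have "cmod (schrodinger_fun adj V \<phi> v) \<le> x + y"
      unfolding eq x_def
      by (intro order_trans[OF norm_triangle_ineq] add_mono norm_sum)
    then have "(cmod (schrodinger_fun adj V \<phi> v))\<^sup>2 \<le> (x + y)\<^sup>2"
      by (intro power_mono) simp_all
    also have "\<dots> \<le> 2 * x\<^sup>2 + 2 * y\<^sup>2"
      using zero_le_power2[of "x - y"] by (simp add: power2_sum power2_diff)
    also have "x\<^sup>2 \<le> real (card (N v)) * (\<Sum>w\<in>N v. a w)"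
      using Cauchy_Schwarz_ineq_sum[of "\<lambda>_. 1" "\<lambda>w. cmod (\<phi> w)" "N v"]
      by (simp add: x_def a_def)
    also have "\<dots> \<le> real d * (\<Sum>w\<in>N v. a w)"
      using cardN by (intro mult_right_mono sum_nonneg a0) simp
    finally show ?thesis by (simp add: y_def a_def power_mult_distrib)
  qed
  have "(\<Sum>v\<in>F. \<Sum>w\<in>N v. a w) = (\<Sum>(v, w)\<in>Sigma F N. a w)"
    using F finN by (subst sum.Sigma) auto
  also have "\<dots> = (\<Sum>(w, v)\<in>Sigma (\<Union>v\<in>F. N v) (\<lambda>w. N w \<inter> F). a w)"
    by (rule sum.reindex_bij_witness[of _ prod.swap prod.swap])
      (use iffD1[OF symN] in \<open>auto 0 4\<close>)
  also have "\<dots> = (\<Sum>w\<in>(\<Union>v\<in>F. N v). \<Sum>v\<in>N w \<inter> F. a w)"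
    using F finN by (subst sum.Sigma) auto
  also have "\<dots> \<le> (\<Sum>w\<in>(\<Union>v\<in>F. N v). real d * a w)"
  proof (rule sum_mono)
    fix w
    have "card (N w \<inter> F) \<le> d"
      using card_mono[OF finN[of w], of "N w \<inter> F"] cardN[of w] by simp
    then show "(\<Sum>v\<in>N w \<inter> F. a w) \<le> real d * a w"
      by (simp add: mult_right_mono a0)
  qed
  also have "\<dots> \<le> real d * infsum a UNIV"
    unfolding sum_distrib_left[symmetric]
    using F finN by (intro mult_left_mono asum) auto
  finally have nb: "(\<Sum>v\<in>F. \<Sum>w\<in>N v. a w) \<le> real d * infsum a UNIV" .
  have "(\<Sum>v\<in>F. (cmod (schrodinger_fun adj V \<phi> v))\<^sup>2)
      \<le> (\<Sum>v\<in>F. 2 * (real d * (\<Sum>w\<in>N v. a w)) + 2 * ((c + real d)\<^sup>2 * a v))"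
    by (intro sum_mono pt)
  also have "\<dots> = 2 * (real d * (\<Sum>v\<in>F. \<Sum>w\<in>N v. a w)) + 2 * ((c + real d)\<^sup>2 * sum a F)"
    by (simp add: sum.distrib sum_distrib_left)
  also have "\<dots> \<le> 2 * (real d * (real d * infsum a UNIV)) + 2 * ((c + real d)\<^sup>2 * infsum a UNIV)"
    using nb asum[OF F] by (intro add_mono mult_left_mono) auto
  finally show ?thesis by (simp add: a_def[abs_def] algebra_simps power2_eq_square)
qed

lemma norm_ell2_square: "(norm \<phi>)\<^sup>2 = (\<Sum>\<^sub>\<infinity>v. (cmod (ell2_apply \<phi> v))\<^sup>2)"
proof -
  note summ = square_summable_prod[OF ell2_apply_summable ell2_apply_summable]
  have "inner \<phi> \<phi> = (\<Sum>\<^sub>\<infinity>v. (cmod (ell2_apply \<phi> v))\<^sup>2)"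
    unfolding inner_ell2_def ell2_cinner_def infsum_Re[OF summ, symmetric]
    by (intro infsum_cong) (simp add: cmod_def flip: power2_eq_square)
  then show ?thesis by (simp add: power2_norm_eq_inner)
qed

lemma schrodinger_apply:
  fixes adj :: "'v \<Rightarrow> 'v \<Rightarrow> bool"
  assumes sg: "simple_graph adj" and "bounded_degree adj" and V: "\<And>v. \<bar>V v\<bar> \<le> c"
  shows "ell2_apply (blinfun_apply (schrodinger adj V) \<phi>) = schrodinger_fun adj V (ell2_apply \<phi>)"
proof -
  obtain d where deg: "\<And>v. finite {w. adj v w} \<and> card {w. adj v w} \<le> d"
    using assms(2) unfolding bounded_degree_def by blast
  define K where "K = 2 * (real d)\<^sup>2 + 2 * (c + real d)\<^sup>2"
  define T where "T \<psi> = Abs_ell2 (schrodinger_fun adj V (ell2_apply \<psi>))" for \<psi>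
  note bd = schrodinger_fun_square_sum[where V = V, OF sg deg V ell2_apply_summable, folded K_def]
  have summ: "(\<lambda>v. (cmod (schrodinger_fun adj V (ell2_apply \<psi>) v))\<^sup>2) summable_on UNIV" for \<psi>
    by (rule nonneg_bounded_partial_sums_imp_summable_on
        [where C = "K * (\<Sum>\<^sub>\<infinity>v. (cmod (ell2_apply \<psi> v))\<^sup>2)"])
      (auto intro!: eventually_finite_subsets_at_top_weakI bd)
  have T: "ell2_apply (T \<psi>) = schrodinger_fun adj V (ell2_apply \<psi>)" for \<psi>
    unfolding T_def using summ by (intro Abs_ell2_inverse) simp
  have "bounded_linear T"
  proof (rule bounded_linear_intro[of _ "sqrt K"])
    fix x y :: "'v ell2" and a :: real
    show "T (x + y) = T x + T y"
      by (rule ell2_apply_inject[THEN iffD1])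
        (auto simp: T plus_ell2.rep_eq schrodinger_fun_def fun_eq_iff algebra_simps
          sum.distrib sum_subtractf)
    show "T (a *\<^sub>R x) = a *\<^sub>R T x"
      by (rule ell2_apply_inject[THEN iffD1])
        (auto simp: T scaleR_ell2.rep_eq schrodinger_fun_def fun_eq_iff algebra_simps
          sum_distrib_left sum_subtractf)
    have "(norm (T x))\<^sup>2 \<le> K * (norm x)\<^sup>2"
      unfolding norm_ell2_square T by (intro infsum_le_finite_sums summ bd)
    then show "norm (T x) \<le> norm x * sqrt K"
      by (metis mult.commute real_le_rsqrt real_sqrt_mult real_sqrt_abs abs_norm_cancel)
  qed
  then have "blinfun_apply (schrodinger adj V) = T"
    unfolding schrodinger_def T_def by (rule bounded_linear_Blinfun_apply)
  then show ?thesis by (simp add: T)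
qed

section \<open>Spectral measures\<close>

definition poly_op :: "real poly \<Rightarrow> 'v ell2 \<Rightarrow>\<^sub>L 'v ell2 \<Rightarrow> 'v ell2 \<Rightarrow>\<^sub>L 'v ell2" where
  "poly_op p A = (\<Sum>i\<le>degree p. coeff p i *\<^sub>R ((\<lambda>B. A o\<^sub>L B) ^^ i) id_blinfun)"

text \<open>
  \<open>continuous_calculus A g B\<close> says that \<open>B = g(A)\<close> in the continuous functional calculus of a
  bounded self-adjoint operator \<open>A\<close>. The spectrum of \<open>A\<close> lies in \<open>{- norm A..norm A}\<close>; so by the
  spectral theorem and the theorem of Weierstrass there is exactly one such \<open>B\<close> for every
  continuous \<open>g\<close>.
\<close>

definition continuous_calculus ::
    "'v ell2 \<Rightarrow>\<^sub>L 'v ell2 \<Rightarrow> (real \<Rightarrow> real) \<Rightarrow> 'v ell2 \<Rightarrow>\<^sub>L 'v ell2 \<Rightarrow> bool" where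
  "continuous_calculus A g B \<longleftrightarrow>
     (\<exists>p :: nat \<Rightarrow> real poly.
        uniform_limit {- norm A..norm A} (\<lambda>n. poly (p n)) g sequentially \<and>
        (\<lambda>n. poly_op (p n) A) \<longlonglongrightarrow> B)"

definition is_spectral_measure :: "'v ell2 \<Rightarrow>\<^sub>L 'v ell2 \<Rightarrow> 'v \<Rightarrow> real measure \<Rightarrow> bool" where
  "is_spectral_measure A v \<mu> \<longleftrightarrow>
     finite_measure \<mu> \<and> sets \<mu> = sets borel \<and>
     (\<forall>g B. continuous_on UNIV g \<longrightarrow> continuous_calculus A g B \<longrightarrow>
        integrable \<mu> g \<and>
        ell2_cinner (ell2_delta v) (blinfun_apply B (ell2_delta v)) = of_real (\<integral>x. g x \<partial>\<mu>))"

section \<open>Propagating graphs\<close>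

definition int_iterate :: "('v \<Rightarrow> 'v) \<Rightarrow> int \<Rightarrow> 'v \<Rightarrow> 'v" where
  "int_iterate f k = (if 0 \<le> k then f ^^ nat k else inv_into UNIV f ^^ nat (- k))"

definition int_orbits :: "('v \<Rightarrow> 'v) \<Rightarrow> 'v set set" where
  "int_orbits f = range (\<lambda>v. range (\<lambda>k. int_iterate f k v))"

definition free_int_action :: "('v \<Rightarrow> 'v) \<Rightarrow> bool" where
  "free_int_action f \<longleftrightarrow> bij f \<and> (\<forall>k v. int_iterate f k v = v \<longrightarrow> k = 0)"

definition orbit_representatives :: "('v \<Rightarrow> 'v) \<Rightarrow> 'v set \<Rightarrow> bool" where
  "orbit_representatives f S \<longleftrightarrow> (\<forall>Q\<in>int_orbits f. \<exists>!v. v \<in> S \<inter> Q)"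

definition graph_automorphism :: "('v \<Rightarrow> 'v \<Rightarrow> bool) \<Rightarrow> ('v \<Rightarrow> 'v) \<Rightarrow> bool" where
  "graph_automorphism adj f \<longleftrightarrow> bij f \<and> (\<forall>v w. adj (f v) (f w) \<longleftrightarrow> adj v w)"

definition propagating :: "('v \<Rightarrow> 'v \<Rightarrow> bool) \<Rightarrow> ('v \<Rightarrow> 'v) \<Rightarrow> 'v rel \<Rightarrow> bool" where
  "propagating adj f R \<longleftrightarrow>
     graph_automorphism adj f \<and> free_int_action f \<and> finite (int_orbits f) \<and>
     partial_order_on UNIV R \<and>
     (\<forall>v w. (f v, f w) \<in> R \<longleftrightarrow> (v, w) \<in> R) \<and>
     (\<forall>v. (v, f v) \<in> R \<and> v \<noteq> f v) \<and>
     (\<forall>v. adj (f v) v) \<and>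
     (\<forall>v w. adj v w \<longrightarrow> (inv_into UNIV f v, w) \<in> R \<and> (w, f v) \<in> R)"

definition periodic_potential :: "('v \<Rightarrow> 'v) \<Rightarrow> nat \<Rightarrow> ('v \<Rightarrow> real) \<Rightarrow> bool" where
  "periodic_potential f p V \<longleftrightarrow> p \<ge> 1 \<and> (\<forall>v. V ((f ^^ p) v) = V v)"

definition average_measure :: "'v set \<Rightarrow> ('v \<Rightarrow> real measure) \<Rightarrow> real measure" where
  "average_measure S \<sigma> =
     measure_of UNIV (sets borel) (\<lambda>X. (\<Sum>v\<in>S. emeasure (\<sigma> v) X) / of_nat (card S))"

definition is_density_of_states ::
    "('v \<Rightarrow> 'v \<Rightarrow> bool) \<Rightarrow> ('v \<Rightarrow> real) \<Rightarrow> ('v \<Rightarrow> 'v) \<Rightarrow> nat \<Rightarrow> real measure \<Rightarrow> bool" where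
  "is_density_of_states adj V f p \<mu> \<longleftrightarrow>
     (\<exists>S \<sigma>. orbit_representatives (f ^^ p) S \<and>
        (\<forall>v\<in>S. is_spectral_measure (schrodinger adj V) v (\<sigma> v)) \<and>
        \<mu> = average_measure S \<sigma>)"

section \<open>Lyapunov exponents and the growth rate\<close>

text \<open>
  \<open>order_identification adj f R e\<close>: the total order pulled back along the enumeration \<open>e\<close> from
  the integers extends \<open>R\<close> and still makes the graph propagating with respect to \<open>f\<close>.
\<close>

definition order_identification ::
    "('v \<Rightarrow> 'v \<Rightarrow> bool) \<Rightarrow> ('v \<Rightarrow> 'v) \<Rightarrow> 'v rel \<Rightarrow> (int \<Rightarrow> 'v) \<Rightarrow> bool" where
  "order_identification adj f R e \<longleftrightarrow>
     (\<exists>L. linear_order_on UNIV L \<and> R \<subseteq> L \<and> propagating adj f L \<and>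
        bij e \<and> (\<forall>m n. (e m, e n) \<in> L \<longleftrightarrow> m \<le> n))"

definition hat_potential :: "('v \<Rightarrow> 'v \<Rightarrow> bool) \<Rightarrow> ('v \<Rightarrow> real) \<Rightarrow> (int \<Rightarrow> 'v) \<Rightarrow> int \<Rightarrow> real" where
  "hat_potential adj V e n = V (e n) - real (card {w. adj (e n) w})"

text \<open>
  Rows and columns are numbered from 0. Column \<open>m\<close> of the last row is the coefficient of
  \<open>u (n + m)\<close> in the expression for \<open>u (n + 2 * r)\<close> obtained from \<open>(H u) (n + r) = E * u (n + r)\<close>.
\<close>

definition transfer_matrix ::
    "('v \<Rightarrow> 'v \<Rightarrow> bool) \<Rightarrow> ('v \<Rightarrow> real) \<Rightarrow> (int \<Rightarrow> 'v) \<Rightarrow> nat \<Rightarrow> complex \<Rightarrow> int \<Rightarrow> complex mat" where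
  "transfer_matrix adj V e r E n = Matrix.mat (2 * r) (2 * r) (\<lambda>(j, m).
     if j < 2 * r - 1 then of_bool (m = j + 1)
     else (if m = r then E - of_real (hat_potential adj V e (n + int r)) else 0)
          - of_bool (adj (e (n + int r)) (e (n + int m))))"

primrec transfer_product ::
    "('v \<Rightarrow> 'v \<Rightarrow> bool) \<Rightarrow> ('v \<Rightarrow> real) \<Rightarrow> (int \<Rightarrow> 'v) \<Rightarrow> nat \<Rightarrow> complex \<Rightarrow> nat \<Rightarrow> complex mat" where
  "transfer_product adj V e r E 0 = 1\<^sub>m (2 * r)"
| "transfer_product adj V e r E (Suc n) =
     transfer_matrix adj V e r E (int (Suc n)) * transfer_product adj V e r E n"

definition l2_operator_norm :: "'i set \<Rightarrow> 'j set \<Rightarrow> ('i \<Rightarrow> 'j \<Rightarrow> complex) \<Rightarrow> real" where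
  "l2_operator_norm I J M =
     (SUP x\<in>{x. L2_set (\<lambda>j. cmod (x j)) J \<le> 1}. L2_set (\<lambda>i. cmod (\<Sum>j\<in>J. M i j * x j)) I)"

text \<open>
  In the orthonormal basis of the vectors \<open>e\<^sub>J = e\<^sub>j\<^sub>1 \<and> \<dots> \<and> e\<^sub>j\<^sub>k\<close>, for sets
  \<open>J = {j\<^sub>1 < \<dots> < j\<^sub>k}\<close>, the matrix of the \<open>k\<close>-th exterior power of \<open>M\<close> has as its entries the
  minors of order \<open>k\<close> of \<open>M\<close>.
\<close>

definition exterior_power_entry :: "complex mat \<Rightarrow> nat set \<Rightarrow> nat set \<Rightarrow> complex" where
  "exterior_power_entry M I J = Determinant.det (submatrix M I J)"

definition exterior_power_norm :: "nat \<Rightarrow> complex mat \<Rightarrow> real" where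
  "exterior_power_norm k M =
     l2_operator_norm {I. I \<subseteq> {..<dim_row M} \<and> card I = k} {J. J \<subseteq> {..<dim_col M} \<and> card J = k}
       (exterior_power_entry M)"

definition lyapunov_sum ::
    "('v \<Rightarrow> 'v \<Rightarrow> bool) \<Rightarrow> ('v \<Rightarrow> real) \<Rightarrow> (int \<Rightarrow> 'v) \<Rightarrow> nat \<Rightarrow> complex \<Rightarrow> nat \<Rightarrow> real" where
  "lyapunov_sum adj V e r E k =
     lim (\<lambda>n. ln (exterior_power_norm k (transfer_product adj V e r E n)) / real n)"

text \<open>
  For \<open>k = 0\<close> the exterior power is the identity of a one-dimensional space, so
  \<open>lyapunov_sum adj V e r E 0 = 0\<close>.
\<close>

definition lyapunov_exponent ::
    "('v \<Rightarrow> 'v \<Rightarrow> bool) \<Rightarrow> ('v \<Rightarrow> real) \<Rightarrow> (int \<Rightarrow> 'v) \<Rightarrow> nat \<Rightarrow> complex \<Rightarrow> nat \<Rightarrow> real" where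
  "lyapunov_exponent adj V e r E k = lyapunov_sum adj V e r E k - lyapunov_sum adj V e r E (k - 1)"

definition growth_rate ::
    "('v \<Rightarrow> 'v \<Rightarrow> bool) \<Rightarrow> ('v \<Rightarrow> real) \<Rightarrow> ('v \<Rightarrow> 'v) \<Rightarrow> (int \<Rightarrow> 'v) \<Rightarrow> complex \<Rightarrow> real" where
  "growth_rate adj V f e E =
     (\<Sum>k=1..card (int_orbits f). lyapunov_exponent adj V e (card (int_orbits f)) E k)"

end

(*
  Let h be the matrix of H in the coordinates given by e, h_n its Dirichlet truncation to an
  interval of length n, and D = E - h_n. A minor of order r of T_n is, up to sign, the determinant of
  the n difference equations completed by 2r coordinate functionals. Evaluating that determinant on
  solutions of the Dirichlet problem factors it as det D times a determinant of size 2r of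
  boundary solutions. These are bounded uniformly in n, because the inverse of D is bounded by
  1/|Im E|; for the functionals at the two outer ends the factor is 1. So the norm of the
  r-th exterior power of T_n lies between |det D| and a constant times |det D|.

  Also log |det D| = sum of log |x - E| over the eigenvalues x of h_n, which are real and bounded.
  Their moments tr (h_n)^k / n converge to those of the density of states, as h is banded and
  periodic, so by the theorem of Weierstrass log |det D| / n converges to the integral of
  log |x - E|. Finally the growth rate telescopes to the limit of log |Lambda^r T_n| / n.
*)

theory Submission
  imports Defs "Jordan_Normal_Form.Schur_Decomposition"
begin

section \<open>Determinants and minors\<close>

text \<open>The completed system of \<open>n\<close> equations and \<open>2 * r\<close> coordinate
  functionals has one determinant up to sign, but every choice of \<open>2 * r\<close> coordinates
  at which solutions are normalised factors it differently. Normalising at the first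
  \<open>2 * r\<close> coordinates produces the rows of the transfer product and leaves a triangular
  block with diagonal -1. Normalising at the two ends leaves the Dirichlet matrix instead. Equating
  the two trades entries that may grow exponentially for bounded ones times a single determinant.

  That E is not real enters in three ways: the Dirichlet matrix is invertible, its inverse is
  bounded independently of \<open>n\<close>, and log |x - E| is continuous on the whole real line,
  so that convergence of moments decides the limit.

  Spectral measures are tested only against monomials and against one function vanishing on
  \<open>{- norm A..norm A}\<close>. The monomials give the diagonal entries of the powers of H; the
  other function gives a bounded support. Eigenvalues and measure thus live on one compact interval,
  where polynomials are dense among continuous functions.\<close>

lemma sum_of_bool_mult:
  fixes f :: "'a \<Rightarrow> 'b :: semiring_1"
  assumes "finite A" "a \<in> A"
  shows "(\<Sum>x\<in>A. of_bool (x = a) * f x) = f a" "(\<Sum>x\<in>A. f x * of_bool (x = a)) = f a"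
    "(\<Sum>x\<in>A. of_bool (a = x) * f x) = f a" "(\<Sum>x\<in>A. f x * of_bool (a = x)) = f a"
  using assms by (simp_all add: of_bool_def if_distrib if_distribR sum.delta sum.delta' cong: if_cong)

lemma cmod_det_permute_cols:
  fixes F :: "nat \<Rightarrow> nat \<Rightarrow> complex"
  assumes c: "bij_betw c {..<n} {..<n}"
  shows "cmod (Determinant.det (Matrix.mat n n (\<lambda>(i, j). F i (c j))))
    = cmod (Determinant.det (Matrix.mat n n (\<lambda>(i, j). F i j)))"
proof -
  define q where "q i = (if i < n then c i else i)" for i
  have q: "q permutes {0..<n}"
    unfolding permutes_altdef
  proof
    show "bij_betw q {0..<n} {0..<n}"
      using c by (subst bij_betw_cong[of _ _ c]) (auto simp: q_def atLeast0LessThan)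
  qed (auto simp: q_def)
  define A where "A = Matrix.mat n n (\<lambda>(i, j). F j i)"
  have A: "A \<in> carrier_mat n n" by (simp add: A_def)
  have lt: "c j < n" if "j < n" for j using c that by (auto simp: bij_betw_def)
  have "Determinant.det (Matrix.mat n n (\<lambda>(i, j). F i (c j)))
      = Determinant.det (Matrix.mat n n (\<lambda>(i, j). A $$ (q i, j)))"
    by (subst det_transpose[symmetric, of _ n], simp, rule arg_cong[of _ _ Determinant.det], rule eq_matI)
      (auto simp: A_def q_def lt)
  also have "\<dots> = signof q * Determinant.det A"
    by (rule det_permute_rows[OF A q])
  also have "Determinant.det A = Determinant.det (Matrix.mat n n (\<lambda>(i, j). F i j))"
    by (subst det_transpose[symmetric, of _ n], simp add: A_def, rule arg_cong[of _ _ Determinant.det], rule eq_matI)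
      (auto simp: A_def)
  finally show ?thesis by (simp add: norm_mult sign_def)
qed

text \<open>The map \<open>c\<close> lists the coordinates with the \<open>m\<close> free ones in
  front. Right multiplication by a unit lower triangular matrix, whose first \<open>m\<close>
  columns are the solutions, puts the values of all rows on these solutions into the first
  \<open>m\<close> columns. The equations vanish there, so a block triangular matrix
  remains.\<close>

lemma det_solution_rows:
  fixes B X :: "nat \<Rightarrow> nat \<Rightarrow> complex"
  assumes c: "bij_betw c {..<m + n} {..<m + n}"
    and s: "\<And>i. i < m \<Longrightarrow> s i < m + n"
    and X: "\<And>i j. i < m \<Longrightarrow> j < m \<Longrightarrow> X (c i) j = of_bool (i = j)"
    and BX: "\<And>k j. k < n \<Longrightarrow> j < m \<Longrightarrow> (\<Sum>l<m + n. B k l * X l j) = 0"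
  shows "Determinant.det (Matrix.mat (m + n) (m + n)
      (\<lambda>(i, j). if i < m then of_bool (c j = s i) else B (i - m) (c j)))
    = Determinant.det (Matrix.mat m m (\<lambda>(i, j). X (s i) j))
      * Determinant.det (Matrix.mat n n (\<lambda>(k, l). B k (c (m + l))))"
proof -
  define W where "W = Matrix.mat (m + n) (m + n)
      (\<lambda>(i, j). if i < m then of_bool (c j = s i) else B (i - m) (c j))"
  define Z where "Z = Matrix.mat (m + n) (m + n)
      (\<lambda>(i, j). if j < m then X (c i) j else of_bool (i = j))"
  define X' where "X' = Matrix.mat m m (\<lambda>(i, j). X (s i) j)"
  define D where "D = Matrix.mat n n (\<lambda>(k, l). B k (c (m + l)))"
  define Q where "Q = Matrix.mat m n (\<lambda>(i, j). of_bool (c (m + j) = s i) :: complex)"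
  have WC: "W \<in> carrier_mat (m + n) (m + n)" and ZC: "Z \<in> carrier_mat (m + n) (m + n)"
    by (auto simp: W_def Z_def)
  have "Determinant.det Z = prod_list (diag_mat Z)"
    by (rule det_lower_triangular[OF _ ZC]) (auto simp: Z_def X)
  also have "\<dots> = 1"
    unfolding prod_list_diag_prod by (rule prod.neutral) (auto simp: Z_def X)
  finally have detZ: "Determinant.det Z = 1" .
  have "W * Z = four_block_mat X' Q (0\<^sub>m n m) D"
  proof (rule eq_matI)
    fix i j
    assume "i < dim_row (four_block_mat X' Q (0\<^sub>m n m) D)" "j < dim_col (four_block_mat X' Q (0\<^sub>m n m) D)"
    then have ij: "i < m + n" "j < m + n" by (auto simp: X'_def D_def)
    have eq: "(W * Z) $$ (i, j) = (\<Sum>l<m + n. W $$ (i, l) * Z $$ (l, j))"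
      using ij WC ZC by (auto simp: scalar_prod_def atLeast0LessThan intro!: sum.cong)
    have reix: "(\<Sum>l<m + n. g (c l)) = (\<Sum>l<m + n. g l)" for g :: "nat \<Rightarrow> complex"
      by (rule sum.reindex_bij_betw[OF c])
    show "(W * Z) $$ (i, j) = four_block_mat X' Q (0\<^sub>m n m) D $$ (i, j)"
    proof (cases "j < m")
      case j: True
      show ?thesis
      proof (cases "i < m")
        case True
        have "(W * Z) $$ (i, j) = (\<Sum>l<m + n. of_bool (c l = s i) * X (c l) j)"
          unfolding eq using ij True j by (intro sum.cong) (auto simp: W_def Z_def)
        also have "\<dots> = (\<Sum>l<m + n. of_bool (l = s i) * X l j)"
          using reix[of "\<lambda>l. of_bool (l = s i) * X l j"] .
        also have "\<dots> = X (s i) j"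
          using s[OF True] by (intro sum_of_bool_mult) auto
        finally show ?thesis using True j by (simp add: X'_def D_def)
      next
        case False
        have "(W * Z) $$ (i, j) = (\<Sum>l<m + n. B (i - m) (c l) * X (c l) j)"
          unfolding eq using ij False j by (intro sum.cong) (auto simp: W_def Z_def)
        also have "\<dots> = (\<Sum>l<m + n. B (i - m) l * X l j)"
          using reix[of "\<lambda>l. B (i - m) l * X l j"] .
        also have "\<dots> = 0" using BX[of "i - m" j] False ij j by simp
        finally show ?thesis using False j ij by (simp add: X'_def D_def)
      qed
    next
      case j: False
      have "(W * Z) $$ (i, j) = (\<Sum>l<m + n. W $$ (i, l) * of_bool (l = j))"
        unfolding eq using ij j by (intro sum.cong) (auto simp: Z_def)
      also have "\<dots> = W $$ (i, j)" using ij by (intro sum_of_bool_mult) auto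
      finally show ?thesis using ij j by (auto simp: W_def X'_def Q_def D_def)
    qed
  qed (auto simp: W_def Z_def X'_def D_def)
  then have "Determinant.det W * Determinant.det Z = Determinant.det (four_block_mat X' Q (0\<^sub>m n m) D)"
    using det_mult[OF WC ZC] by simp
  also have "\<dots> = Determinant.det X' * Determinant.det D"
    by (rule det_four_block_mat_lower_left_zero) (auto simp: X'_def Q_def D_def)
  finally show ?thesis by (simp add: detZ W_def X'_def D_def)
qed

text \<open>In absolute value the left side no longer contains \<open>c\<close>. The same
  determinant can therefore be evaluated for two choices of free coordinates and the results
  compared.\<close>

lemma cmod_det_solution_rows:
  fixes B X :: "nat \<Rightarrow> nat \<Rightarrow> complex"
  assumes c: "bij_betw c {..<m + n} {..<m + n}"
    and s: "\<And>i. i < m \<Longrightarrow> s i < m + n"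
    and X: "\<And>i j. i < m \<Longrightarrow> j < m \<Longrightarrow> X (c i) j = of_bool (i = j)"
    and BX: "\<And>k j. k < n \<Longrightarrow> j < m \<Longrightarrow> (\<Sum>l<m + n. B k l * X l j) = 0"
  shows "cmod (Determinant.det (Matrix.mat (m + n) (m + n)
      (\<lambda>(i, j). if i < m then of_bool (j = s i) else B (i - m) j)))
    = cmod (Determinant.det (Matrix.mat m m (\<lambda>(i, j). X (s i) j)))
      * cmod (Determinant.det (Matrix.mat n n (\<lambda>(k, l). B k (c (m + l)))))"
  using det_solution_rows[of c m n s X B, OF c s X BX]
    cmod_det_permute_cols[OF c, of "\<lambda>i j. if i < m then of_bool (j = s i) else B (i - m) j"]
  by (simp add: norm_mult)

text \<open>The minor of \<open>T\<close> with rows \<open>I\<close> and columns \<open>J\<close> is, up to sign, the determinant of the matrix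
  formed by the rows \<open>I\<close> of \<open>T\<close> and the coordinate functionals of the columns outside \<open>J\<close>. The rows
  are indexed in a sequence of solutions, whose entries from \<open>n\<close> on are the rows of \<open>T\<close>.\<close>

definition minor_rows :: "nat \<Rightarrow> nat \<Rightarrow> nat set \<Rightarrow> nat set \<Rightarrow> nat \<Rightarrow> nat" where
  "minor_rows r n I J i = (if i < r then pick ({..<2 * r} - J) i else n + pick I (i - r))"

lemma pick_bij:
  assumes "finite I"
  shows "bij_betw (pick I) {..<card I} I"
proof -
  have "inj_on (pick I) {..<card I}"
  proof (rule inj_onI)
    fix x y assume "x \<in> {..<card I}" "y \<in> {..<card I}" "pick I x = pick I y"
    then show "x = y"
      using pick_mono_le[of y I x] pick_mono_le[of x I y] by (cases x y rule: linorder_cases) auto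
  qed
  moreover have "pick I ` {..<card I} \<subseteq> I" by (auto intro: pick_in_set_le)
  ultimately show ?thesis
    using assms by (simp add: bij_betw_def card_image card_subset_eq)
qed

text \<open>Listing the columns outside \<open>J\<close> before those in \<open>J\<close> makes the
  matrix block triangular: the coordinate functionals contribute an identity block and a zero block,
  and the minor is the other diagonal block.\<close>

lemma cmod_det_submatrix:
  fixes T :: "complex mat" and Y :: "nat \<Rightarrow> nat \<Rightarrow> complex"
  assumes T: "T \<in> carrier_mat (2 * r) (2 * r)"
    and I: "I \<subseteq> {..<2 * r}" "card I = r" and J: "J \<subseteq> {..<2 * r}" "card J = r"
    and Y0: "\<And>i j. i < 2 * r \<Longrightarrow> j < 2 * r \<Longrightarrow> Y i j = of_bool (i = j)"
    and YT: "\<And>i j. i < 2 * r \<Longrightarrow> j < 2 * r \<Longrightarrow> Y (n + i) j = T $$ (i, j)"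
  shows "cmod (Determinant.det (submatrix T I J))
    = cmod (Determinant.det (Matrix.mat (2 * r) (2 * r) (\<lambda>(i, j). Y (minor_rows r n I J i) j)))"
proof -
  let ?J' = "{..<2 * r} - J"
  define c where "c j = (if j < r then pick ?J' j else pick J (j - r))" for j
  have fin: "finite I" "finite J" "finite ?J'" using I J by (auto intro: finite_subset)
  have cJ': "card ?J' = r" using J fin by (simp add: card_Diff_subset)
  have bJ': "bij_betw (pick ?J') {..<r} ?J'" and bJ: "bij_betw (pick J) {..<r} J"
    and bI: "bij_betw (pick I) {..<r} I"
    using pick_bij[OF fin(3)] pick_bij[OF fin(2)] pick_bij[OF fin(1)] cJ' J I by auto
  have c: "bij_betw c {..<2 * r} {..<2 * r}"
  proof -
    have 1: "bij_betw c {..<r} ?J'"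
      using bJ' by (subst bij_betw_cong[of _ _ "pick ?J'"]) (auto simp: c_def)
    have "bij_betw (\<lambda>j. j - r) {r..<2 * r} {..<r}"
      by (rule bij_betwI[of _ _ _ "\<lambda>j. j + r"]) auto
    from bij_betw_trans[OF this bJ] have 2: "bij_betw c {r..<2 * r} J"
      by (subst bij_betw_cong[of _ _ "pick J \<circ> (\<lambda>j. j - r)"]) (auto simp: c_def)
    have "{..<r} \<union> {r..<2 * r} = {..<2 * r}" "?J' \<union> J = {..<2 * r}" using J by auto
    then show ?thesis using bij_betw_combine[OF 1 2] by auto
  qed
  have pJ': "pick ?J' i \<in> ?J'" "pick J i \<in> J" "pick I i \<in> I" if "i < r" for i
    using bJ' bJ bI that by (auto simp: bij_betw_def)
  have pl: "pick ?J' i < 2 * r" "pick J i < 2 * r" "pick I i < 2 * r" if "i < r" for i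
    using pJ'[OF that] I J by auto
  have inj: "pick ?J' i = pick ?J' j \<longleftrightarrow> i = j" if "i < r" "j < r" for i j
    using bJ' that by (auto simp: bij_betw_def inj_on_def)
  have ne: "pick ?J' i \<noteq> pick J j" if "i < r" "j < r" for i j
    using pJ'(1)[OF that(1)] pJ'(2)[OF that(2)] by auto
  let ?F = "\<lambda>i j. Y (minor_rows r n I J i) j"
  define Q where "Q = Matrix.mat r r (\<lambda>(i, j). T $$ (pick I i, pick ?J' j))"
  have sub: "submatrix T I J \<in> carrier_mat r r"
  proof -
    have "{i. i < 2 * r \<and> i \<in> I} = I" "{i. i < 2 * r \<and> i \<in> J} = J" using I J by auto
    then show ?thesis using T I J by (simp add: submatrix_def)
  qed
  have subi: "submatrix T I J $$ (i, j) = T $$ (pick I i, pick J j)" if "i < r" "j < r" for i j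
    using that sub by (subst submatrix_index) (auto simp: dim_submatrix)
  have "Matrix.mat (2 * r) (2 * r) (\<lambda>(i, j). ?F i (c j))
      = four_block_mat (1\<^sub>m r) (0\<^sub>m r r) Q (submatrix T I J)"
    by (rule eq_matI)
      (use sub in \<open>auto simp: Y0 YT pl minor_rows_def c_def Q_def subi inj ne\<close>)
  then have "Determinant.det (Matrix.mat (2 * r) (2 * r) (\<lambda>(i, j). ?F i (c j)))
      = Determinant.det (submatrix T I J)"
    using det_four_block_mat_upper_right_zero[of "1\<^sub>m r" r "0\<^sub>m r r" r Q "submatrix T I J"] sub
    by (simp add: Q_def)
  then show ?thesis using cmod_det_permute_cols[OF c, of ?F] by simp
qed

lemma minor_rows_less:
  assumes I: "I \<subseteq> {..<2 * r}" "card I = r" and J: "J \<subseteq> {..<2 * r}" "card J = r"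
    and i: "i < 2 * r"
  shows "minor_rows r n I J i < 2 * r + n"
proof (cases "i < r")
  case True
  have "card ({..<2 * r} - J) = r" using J by (simp add: card_Diff_subset finite_subset[OF J(1)])
  then have "pick ({..<2 * r} - J) i \<in> {..<2 * r} - J" using True by (intro pick_in_set_le) auto
  then show ?thesis using True by (simp add: minor_rows_def)
next
  case False
  have "pick I (i - r) \<in> I" using False i I by (intro pick_in_set_le) auto
  then show ?thesis using False I by (auto simp: minor_rows_def)
qed

section \<open>Minors of transfer products of banded operators\<close>

lemma sum_lessThan_add:
  fixes g :: "nat \<Rightarrow> 'a :: comm_monoid_add"
  shows "(\<Sum>l<a + n. g l) = (\<Sum>l<a. g l) + (\<Sum>l<n. g (a + l))"
  by (induction n) (simp_all add: add.assoc)

text \<open>The Leibniz expansion has \<open>fact m\<close> terms of modulus at most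
  \<open>K ^ m\<close>. It is applied with \<open>m = 2 * r\<close>, so the resulting constant does
  not depend on the length of the truncation.\<close>

lemma cmod_det_le:
  assumes A: "A \<in> carrier_mat m m" and b: "\<And>i j. i < m \<Longrightarrow> j < m \<Longrightarrow> cmod (A $$ (i, j)) \<le> K"
  shows "cmod (Determinant.det A) \<le> fact m * K ^ m"
proof -
  have "cmod (Determinant.det A)
      \<le> (\<Sum>p | p permutes {0..<m}. cmod (signof p * (\<Prod>i = 0..<m. A $$ (i, p i))))"
    unfolding det_def'[OF A] by (rule norm_sum)
  also have "\<dots> \<le> (\<Sum>p | p permutes {0..<m}. K ^ m)"
  proof (rule sum_mono)
    fix p assume "p \<in> {p. p permutes {0..<m}}"
    then have p: "p i < m" if "i < m" for i using that permutes_in_image[of p "{0..<m}" i] by auto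
    have "cmod (signof p * (\<Prod>i = 0..<m. A $$ (i, p i))) = (\<Prod>i = 0..<m. cmod (A $$ (i, p i)))"
      by (simp add: norm_mult sign_def prod_norm)
    also have "\<dots> \<le> (\<Prod>i = 0..<m. K)"
      by (rule prod_mono) (auto intro!: b p)
    finally show "cmod (signof p * (\<Prod>i = 0..<m. A $$ (i, p i))) \<le> K ^ m" by simp
  qed
  also have "\<dots> = fact m * K ^ m"
    by (simp add: card_permutations)
  finally show ?thesis .
qed

text \<open>The quadratic form of a real symmetric matrix is real on complex vectors, so the
  imaginary part of the pairing of \<open>x\<close> with (E - G) x is Im E times the squared norm of
  \<open>x\<close>. Cauchy-Schwarz bounds the pairing, and one factor of the squared norm
  cancels.\<close>

lemma resolvent_bound:
  fixes G :: "nat \<Rightarrow> nat \<Rightarrow> real" and x y :: "nat \<Rightarrow> complex"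
  assumes sym: "\<And>k l. G k l = G l k"
    and eq: "\<And>k. k < n \<Longrightarrow> (\<Sum>l<n. (E * of_bool (k = l) - of_real (G k l)) * x l) = y k"
  shows "(Im E)\<^sup>2 * (\<Sum>k<n. (cmod (x k))\<^sup>2) \<le> (\<Sum>k<n. (cmod (y k))\<^sup>2)"
proof -
  define S where "S = (\<Sum>k<n. (cmod (x k))\<^sup>2)"
  define Q where "Q = (\<Sum>k<n. \<Sum>l<n. cnj (x k) * of_real (G k l) * x l)"
  have S0: "S \<ge> 0" by (simp add: S_def sum_nonneg)
  have "cnj Q = (\<Sum>k<n. \<Sum>l<n. cnj (x l) * of_real (G k l) * x k)"
    unfolding Q_def cnj_sum by (intro sum.cong) (auto simp: mult_ac)
  also have "\<dots> = (\<Sum>l<n. \<Sum>k<n. cnj (x l) * of_real (G k l) * x k)" by (rule sum.swap)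
  also have "\<dots> = Q" unfolding Q_def by (intro sum.cong) (auto simp: sym[of _ _])
  finally have ImQ: "Im Q = 0" by (metis complex_cnj_cancel_iff Reals_cnj_iff complex_is_Real_iff)
  have "(\<Sum>k<n. cnj (x k) * y k)
      = (\<Sum>k<n. \<Sum>l<n. E * (of_bool (k = l) * (cnj (x k) * x l)) - cnj (x k) * of_real (G k l) * x l)"
    by (intro sum.cong refl) (simp add: eq[symmetric] sum_distrib_left algebra_simps)
  also have "\<dots> = E * (\<Sum>k<n. \<Sum>l<n. of_bool (k = l) * (cnj (x k) * x l)) - Q"
    by (simp only: sum_subtractf Q_def sum_distrib_left)
  also have "(\<Sum>k<n. \<Sum>l<n. of_bool (k = l) * (cnj (x k) * x l)) = of_real S"
    unfolding S_def of_real_sum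
  proof (intro sum.cong refl)
    fix k assume "k \<in> {..<n}"
    then have "(\<Sum>l<n. of_bool (k = l) * (cnj (x k) * x l)) = cnj (x k) * x k"
      by (intro sum_of_bool_mult) auto
    also have "\<dots> = of_real ((cmod (x k))\<^sup>2)"
      by (metis complex_norm_square mult.commute of_real_power)
    finally show "(\<Sum>l<n. of_bool (k = l) * (cnj (x k) * x l)) = of_real ((cmod (x k))\<^sup>2)" .
  qed
  finally have "Im (\<Sum>k<n. cnj (x k) * y k) = Im E * S" by (simp add: ImQ)
  then have "\<bar>Im E\<bar> * S \<le> cmod (\<Sum>k<n. cnj (x k) * y k)"
    by (metis S0 abs_Im_le_cmod abs_mult abs_of_nonneg)
  also have "\<dots> \<le> (\<Sum>k<n. cmod (x k) * cmod (y k))"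
    by (rule order_trans[OF norm_sum]) (simp add: norm_mult)
  finally have "(\<bar>Im E\<bar> * S)\<^sup>2 \<le> (\<Sum>k<n. cmod (x k) * cmod (y k))\<^sup>2"
    using S0 by (intro power_mono) auto
  also have "\<dots> \<le> S * (\<Sum>k<n. (cmod (y k))\<^sup>2)"
    unfolding S_def by (rule Cauchy_Schwarz_ineq_sum)
  finally have "S * ((Im E)\<^sup>2 * S) \<le> S * (\<Sum>k<n. (cmod (y k))\<^sup>2)"
    by (simp add: power2_eq_square algebra_simps)
  then show ?thesis
    using S0 by (cases "S = 0") (auto simp: sum_nonneg simp flip: S_def)
qed

text \<open>An abstraction of the matrix of H in integer coordinates, where \<open>r\<close> will be
  the number of orbits of \<open>f\<close> and \<open>P\<close> the translation length of its
  \<open>p\<close>-th iterate. The condition \<open>h_edge\<close> reflects the adjacency of a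
  vertex and its image under \<open>f\<close>; it allows every difference equation to be solved for
  its last unknown.\<close>

locale banded =
  fixes h :: "int \<Rightarrow> int \<Rightarrow> real" and r P :: nat and C :: real
  assumes r_pos: "0 < r" and P_pos: "0 < P"
    and h_sym: "h a b = h b a"
    and h_band: "\<bar>a - b\<bar> > int r \<Longrightarrow> h a b = 0"
    and h_edge: "h a (a + int r) = 1"
    and h_bound: "\<bar>h a b\<bar> \<le> C"
    and h_periodic: "h (a + int P) (b + int P) = h a b"
begin

section \<open>Transfer matrices, difference equations and fundamental solutions\<close>

definition transfer :: "complex \<Rightarrow> int \<Rightarrow> complex mat" where
  "transfer E n = Matrix.mat (2 * r) (2 * r) (\<lambda>(j, m).
     if j < 2 * r - 1 then of_bool (m = j + 1)
     else E * of_bool (m = r) - of_real (h (n + int r) (n + int m)))"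

primrec transfer_prod :: "complex \<Rightarrow> nat \<Rightarrow> complex mat" where
  "transfer_prod E 0 = 1\<^sub>m (2 * r)"
| "transfer_prod E (Suc n) = transfer E (int (Suc n)) * transfer_prod E n"

text \<open>An index \<open>l\<close> into a solution stands for the site \<open>l + 1\<close>,
  because the first factor \<open>transfer E 1\<close> acts on the values at the sites 1 to
  \<open>2 * r\<close>. The equation it encodes is centred at the site \<open>r + 1\<close>; hence
  the interval runs from \<open>r + 1\<close> to \<open>r + n\<close>.\<close>

definition truncation :: "nat \<Rightarrow> nat \<Rightarrow> nat \<Rightarrow> real" where
  "truncation n k l = h (int (k + r + 1)) (int (l + r + 1))"

definition shifted :: "complex \<Rightarrow> nat \<Rightarrow> complex mat" where
  "shifted E n = Matrix.mat n n (\<lambda>(k, l). E * of_bool (k = l) - of_real (truncation n k l))"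

text \<open>Row \<open>k\<close> is E - h at the site \<open>k + r + 1\<close>, with the column
  \<open>l\<close> belonging to the site \<open>l + 1\<close>. For \<open>k < n\<close> these rows
  involve exactly the sites 1 to \<open>n + 2 * r\<close>.\<close>

definition equation :: "complex \<Rightarrow> nat \<Rightarrow> nat \<Rightarrow> complex" where
  "equation E k l = E * of_bool (l = k + r) - of_real (h (int (k + r + 1)) (int (l + 1)))"

text \<open>The value at the site \<open>l + 1\<close> of the solution whose initial vector is the
  \<open>j\<close>-th unit vector.\<close>

definition fundamental :: "complex \<Rightarrow> nat \<Rightarrow> nat \<Rightarrow> complex" where
  "fundamental E l j = transfer_prod E l $$ (0, j)"

lemma transfer_carrier [simp]: "transfer E n \<in> carrier_mat (2 * r) (2 * r)"
  by (simp add: transfer_def)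

lemma transfer_prod_carrier [simp]: "transfer_prod E n \<in> carrier_mat (2 * r) (2 * r)"
  by (induction n) (auto intro: mult_carrier_mat[OF transfer_carrier])

lemma transfer_prod_Suc_index:
  assumes "i < 2 * r" "j < 2 * r"
  shows "transfer_prod E (Suc n) $$ (i, j)
    = (\<Sum>m<2 * r. transfer E (int (Suc n)) $$ (i, m) * transfer_prod E n $$ (m, j))"
  using assms transfer_carrier[of E "int (Suc n)"] transfer_prod_carrier[of E n]
  by (auto simp: scalar_prod_def atLeast0LessThan simp del: transfer_carrier transfer_prod_carrier
      intro!: sum.cong)

lemma transfer_prod_shift:
  assumes "Suc i < 2 * r" "j < 2 * r"
  shows "transfer_prod E (Suc n) $$ (i, j) = transfer_prod E n $$ (Suc i, j)"
proof -
  have "transfer_prod E (Suc n) $$ (i, j)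
      = (\<Sum>m<2 * r. of_bool (m = Suc i) * transfer_prod E n $$ (m, j))"
    using assms less_diff_conv[of i "2 * r" 1]
    by (subst transfer_prod_Suc_index) (auto simp: transfer_def intro!: sum.cong)
  also have "\<dots> = transfer_prod E n $$ (Suc i, j)"
    using assms by (intro sum_of_bool_mult) auto
  finally show ?thesis .
qed

text \<open>All rows of a transfer matrix except the last only shift, so row \<open>i\<close> of a
  product is row 0 of the product with \<open>i\<close> more factors.\<close>

lemma transfer_prod_fundamental:
  assumes "i < 2 * r" "j < 2 * r"
  shows "fundamental E (n + i) j = transfer_prod E n $$ (i, j)"
  using assms(1)
proof (induction i arbitrary: n)
  case (Suc i)
  then show ?case using Suc.IH[of "Suc n"] transfer_prod_shift[of i j E n] assms by simp
qed (simp add: fundamental_def)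

lemma equation_fundamental:
  assumes k: "k < n" and j: "j < 2 * r"
  shows "(\<Sum>l<2 * r + n. equation E k l * fundamental E l j) = 0"
proof -
  have zero: "equation E k l = 0" if "l \<notin> {k..<k + 2 * r + 1}" for l
    using that unfolding equation_def by (auto simp: h_band)
  have "(\<Sum>l<2 * r + n. equation E k l * fundamental E l j)
      = (\<Sum>l\<in>{k..<k + 2 * r + 1}. equation E k l * fundamental E l j)"
    using k by (intro sum.mono_neutral_right) (auto simp: zero)
  also have "\<dots> = (\<Sum>m = 0..<2 * r + 1. equation E k (m + k) * fundamental E (m + k) j)"
    using sum.shift_bounds_nat_ivl[of "\<lambda>l. equation E k l * fundamental E l j" 0 k "2 * r + 1"]
    by (simp add: add_ac)
  also have "\<dots> = (\<Sum>m<2 * r. equation E k (m + k) * fundamental E (m + k) j)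
      + equation E k (2 * r + k) * fundamental E (2 * r + k) j"
    by (simp add: atLeast0LessThan)
  \<comment> \<open>By \<open>h_edge\<close> the outermost coefficient is -1. The last row of the
    transfer matrix is therefore this very equation, solved for its last unknown.\<close>
  also have "equation E k (2 * r + k) = -1"
    using h_edge[of "int (k + r + 1)"] r_pos by (simp add: equation_def algebra_simps)
  also have "fundamental E (2 * r + k) j = transfer_prod E (Suc k) $$ (2 * r - 1, j)"
    using transfer_prod_fundamental[of "2 * r - 1" j E "Suc k"] j r_pos by (simp add: add_ac)
  also have "\<dots> = (\<Sum>m<2 * r. equation E k (m + k) * fundamental E (m + k) j)"
    using j r_pos
    by (subst transfer_prod_Suc_index)
      (auto simp: transfer_def equation_def add_ac transfer_prod_fundamental[symmetric]
        intro!: sum.cong)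
  finally show ?thesis by simp
qed

text \<open>The coordinates \<open>{..<r} \<union> {n + r..<n + 2 * r}\<close> of a solution are its boundary values for
  the Dirichlet problem on the interval of length \<open>n\<close> in between; they are listed first.\<close>

definition boundary_first :: "nat \<Rightarrow> nat \<Rightarrow> nat" where
  "boundary_first n j = (if j < r then j else if j < 2 * r then n + j else j - r)"

lemma boundary_first_bij: "bij_betw (boundary_first n) {..<2 * r + n} {..<2 * r + n}"
  by (rule bij_betwI[of _ _ _ "\<lambda>l. if l < r then l else if l < n + r then l + r else l - n"])
    (auto simp: boundary_first_def)

section \<open>The Dirichlet problem and its boundary solutions\<close>

lemma shifted_carrier [simp]: "shifted E n \<in> carrier_mat n n"
  by (simp add: shifted_def)

lemma truncation_sym: "truncation n k l = truncation n l k"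
  unfolding truncation_def by (rule h_sym)

lemma shifted_mult_vec:
  assumes "k < n" "v \<in> carrier_vec n"
  shows "(shifted E n *\<^sub>v v) $ k = (\<Sum>l<n. (E * of_bool (k = l) - of_real (truncation n k l)) * v $ l)"
  using assms by (auto simp: shifted_def scalar_prod_def atLeast0LessThan intro!: sum.cong)

lemma det_shifted_nonzero:
  assumes "Im E \<noteq> 0"
  shows "Determinant.det (shifted E n) \<noteq> 0"
proof
  assume "Determinant.det (shifted E n) = 0"
  then obtain v where v: "v \<in> carrier_vec n" "v \<noteq> 0\<^sub>v n" "shifted E n *\<^sub>v v = 0\<^sub>v n"
    using det_0_iff_vec_prod_zero[OF shifted_carrier] by blast
  have "(Im E)\<^sup>2 * (\<Sum>k<n. (cmod (v $ k))\<^sup>2) \<le> (\<Sum>k<n. (cmod (0 :: complex))\<^sup>2)"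
    by (rule resolvent_bound[where G = "truncation n"])
      (auto simp: truncation_sym shifted_mult_vec[OF _ v(1), symmetric] v(3))
  then have "(\<Sum>k<n. (cmod (v $ k))\<^sup>2) \<le> 0" using assms
    by (simp add: mult_le_0_iff)
  then have "\<forall>k<n. v $ k = 0"
    by (simp add: sum_nonneg sum_nonneg_eq_0_iff order_antisym_conv)
  then show False using v by (auto intro: eq_vecI)
qed

lemma shifted_equation: "k < n \<Longrightarrow> l < n \<Longrightarrow> shifted E n $$ (k, l) = equation E k (boundary_first n (2 * r + l))"
  using r_pos by (auto simp: shifted_def equation_def boundary_first_def truncation_def ac_simps)

text \<open>A unit boundary value enters at most \<open>2 * r + 1\<close> equations, with
  coefficients of modulus at most \<open>C\<close>, and the inverse of the Dirichlet matrix has norm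
  at most 1 / |Im E|; this gives the root. The 1 covers the prescribed boundary values
  themselves.\<close>

definition boundary_bound :: "complex \<Rightarrow> real" where
  "boundary_bound E = max 1 (sqrt (real (2 * r + 1) * C\<^sup>2 / (Im E)\<^sup>2))"

lemma boundary_solution:
  assumes E: "Im E \<noteq> 0"
  shows "\<exists>X. (\<forall>i<2 * r. \<forall>j<2 * r. X (boundary_first n i) j = of_bool (i = j)) \<and>
    (\<forall>k<n. \<forall>j<2 * r. (\<Sum>l<2 * r + n. equation E k l * X l j) = 0) \<and>
    (\<forall>l<2 * r + n. \<forall>j<2 * r. cmod (X l j) \<le> boundary_bound E)"
proof -
  let ?c = "boundary_first n"
  define A where "A = shifted E n"
  have A: "A \<in> carrier_mat n n" by (simp add: A_def)
  have dA: "Determinant.det A \<noteq> 0" unfolding A_def by (rule det_shifted_nonzero[OF E])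
  \<comment> \<open>The boundary terms of the equations are moved to the right-hand side; the
    interior values then solve a square system with matrix \<open>A\<close>, inverted below by the
    adjugate.\<close>
  define R where "R = Matrix.mat n (2 * r) (\<lambda>(k, j). - equation E k (?c j))"
  have R: "R \<in> carrier_mat n (2 * r)" by (simp add: R_def)
  define S where "S = inverse (Determinant.det A) \<cdot>\<^sub>m (adj_mat A * R)"
  have S: "S \<in> carrier_mat n (2 * r)" using adj_mat(1)[OF A] R by (simp add: S_def)
  have "A * S = inverse (Determinant.det A) \<cdot>\<^sub>m (A * (adj_mat A * R))"
    unfolding S_def by (rule mult_smult_distrib[OF A]) (use adj_mat(1)[OF A] R in auto)
  also have "A * (adj_mat A * R) = (A * adj_mat A) * R"
    using assoc_mult_mat[OF A adj_mat(1)[OF A] R] by simp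
  also have "\<dots> = Determinant.det A \<cdot>\<^sub>m R"
    unfolding adj_mat(2)[OF A] using R by (simp add: mult_smult_assoc_mat[OF one_carrier_mat R])
  also have "inverse (Determinant.det A) \<cdot>\<^sub>m (Determinant.det A \<cdot>\<^sub>m R) = R"
    using dA R by (intro eq_matI) auto
  finally have AS: "A * S = R" .
  have eqS: "(\<Sum>l<n. A $$ (k, l) * S $$ (l, j)) = - equation E k (?c j)" if "k < n" "j < 2 * r" for k j
  proof -
    have "(A * S) $$ (k, j) = (\<Sum>l<n. A $$ (k, l) * S $$ (l, j))"
      using that A S by (auto simp: scalar_prod_def atLeast0LessThan intro!: sum.cong)
    then show ?thesis using AS that by (simp add: R_def)
  qed
  define X where "X l j = (if l < r then of_bool (l = j) else if l < r + n then S $$ (l - r, j)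
    else of_bool (l - n = j))" for l j
  have Xc: "X (?c i) j = of_bool (i = j)" if "i < 2 * r" "j < 2 * r" for i j
    using that by (auto simp: X_def boundary_first_def)
  have Xc': "X (?c (2 * r + l)) j = S $$ (l, j)" if "l < n" for l j
    using that r_pos by (auto simp: X_def boundary_first_def)
  have eqX: "(\<Sum>l<2 * r + n. equation E k l * X l j) = 0" if kj: "k < n" "j < 2 * r" for k j
  proof -
    have "(\<Sum>l<2 * r + n. equation E k l * X l j) = (\<Sum>l<2 * r + n. equation E k (?c l) * X (?c l) j)"
      by (rule sum.reindex_bij_betw[OF boundary_first_bij, symmetric])
    also have "\<dots> = (\<Sum>l<2 * r. equation E k (?c l) * X (?c l) j)
        + (\<Sum>l<n. equation E k (?c (2 * r + l)) * X (?c (2 * r + l)) j)"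
      by (rule sum_lessThan_add)
    also have "(\<Sum>l<2 * r. equation E k (?c l) * X (?c l) j) = (\<Sum>l<2 * r. equation E k (?c l) * of_bool (l = j))"
      using kj by (intro sum.cong) (auto simp: Xc)
    also have "\<dots> = equation E k (?c j)" using kj by (intro sum_of_bool_mult) auto
    also have "(\<Sum>l<n. equation E k (?c (2 * r + l)) * X (?c (2 * r + l)) j) = (\<Sum>l<n. A $$ (k, l) * S $$ (l, j))"
      using kj by (intro sum.cong) (auto simp: Xc' A_def shifted_equation)
    also have "\<dots> = - equation E k (?c j)" by (rule eqS[OF kj])
    finally show ?thesis by simp
  qed
  have Sb: "cmod (S $$ (l, j)) \<le> boundary_bound E" if l: "l < n" and j: "j < 2 * r" for l j
  proof -
    have "(Im E)\<^sup>2 * (\<Sum>k<n. (cmod (S $$ (k, j)))\<^sup>2) \<le> (\<Sum>k<n. (cmod (- equation E k (?c j)))\<^sup>2)"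
      by (rule resolvent_bound[where G = "truncation n"])
        (use j eqS in \<open>auto simp: truncation_sym A_def shifted_def\<close>)
    also have "\<dots> = (\<Sum>k<n. (h (int (k + r + 1)) (int (?c j + 1)))\<^sup>2)"
      using j by (intro sum.cong) (auto simp: equation_def boundary_first_def)
    \<comment> \<open>Only equations centred within distance \<open>r\<close> of the boundary site
      contain its value, which keeps the number of terms independent of \<open>n\<close>.\<close>
    also have "\<dots> = (\<Sum>k\<in>{..<n} \<inter> {k. \<bar>int (k + r) - int (?c j)\<bar> \<le> int r}. (h (int (k + r + 1)) (int (?c j + 1)))\<^sup>2)"
    proof (rule sum.mono_neutral_right)
      show "\<forall>k\<in>{..<n} - {..<n} \<inter> {k. \<bar>int (k + r) - int (?c j)\<bar> \<le> int r}.
          (h (int (k + r + 1)) (int (?c j + 1)))\<^sup>2 = 0"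
      proof
        fix k assume "k \<in> {..<n} - {..<n} \<inter> {k. \<bar>int (k + r) - int (?c j)\<bar> \<le> int r}"
        then show "(h (int (k + r + 1)) (int (?c j + 1)))\<^sup>2 = 0"
          using h_band[of "int (k + r + 1)" "int (?c j + 1)"] by auto
      qed
    qed auto
    also have "\<dots> \<le> real (card ({..<n} \<inter> {k. \<bar>int (k + r) - int (?c j)\<bar> \<le> int r})) * C\<^sup>2"
      by (intro sum_bounded_above) (metis abs_ge_zero h_bound power2_abs power_mono)
    also have "card ({..<n} \<inter> {k. \<bar>int (k + r) - int (?c j)\<bar> \<le> int r}) \<le> card {?c j - 2 * r..?c j}"
      by (rule card_mono) auto
    also have "card {?c j - 2 * r..?c j} \<le> 2 * r + 1" by simp
    finally have "(Im E)\<^sup>2 * (\<Sum>k<n. (cmod (S $$ (k, j)))\<^sup>2) \<le> real (2 * r + 1) * C\<^sup>2"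
      by (simp add: mult_right_mono)
    moreover have "(cmod (S $$ (l, j)))\<^sup>2 \<le> (\<Sum>k<n. (cmod (S $$ (k, j)))\<^sup>2)"
      using l by (intro member_le_sum) auto
    ultimately have "(cmod (S $$ (l, j)))\<^sup>2 \<le> real (2 * r + 1) * C\<^sup>2 / (Im E)\<^sup>2"
      using E by (simp add: pos_le_divide_eq mult.commute)
        (meson mult_left_mono order_trans zero_le_power2)
    then have "cmod (S $$ (l, j)) \<le> sqrt (real (2 * r + 1) * C\<^sup>2 / (Im E)\<^sup>2)"
      by (rule real_le_rsqrt)
    then show ?thesis by (simp add: boundary_bound_def)
  qed
  have Xb: "cmod (X l j) \<le> boundary_bound E" if "l < 2 * r + n" "j < 2 * r" for l j
    using that Sb[of "l - r" j] by (auto simp: X_def boundary_bound_def)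
  with Xc eqX show ?thesis by blast
qed

text \<open>The completed determinant is factored twice: with the fundamental solutions, whose free
  coordinates are the first \<open>2 * r\<close>, and with the solutions \<open>X\<close>, whose
  free coordinates are the boundary ones.\<close>

lemma cmod_minor:
  assumes I: "I \<subseteq> {..<2 * r}" "card I = r" and J: "J \<subseteq> {..<2 * r}" "card J = r"
    and Xc: "\<And>i j. i < 2 * r \<Longrightarrow> j < 2 * r \<Longrightarrow> X (boundary_first n i) j = of_bool (i = j)"
    and eqX: "\<And>k j. k < n \<Longrightarrow> j < 2 * r \<Longrightarrow> (\<Sum>l<2 * r + n. equation E k l * X l j) = 0"
  shows "cmod (Determinant.det (submatrix (transfer_prod E n) I J))
    = cmod (Determinant.det (Matrix.mat (2 * r) (2 * r) (\<lambda>(i, j). X (minor_rows r n I J i) j)))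
      * cmod (Determinant.det (shifted E n))"
proof -
  let ?s = "minor_rows r n I J"
  note s = minor_rows_less[OF I J, of _ n]
  have init: "fundamental E i j = of_bool (i = j)" if "i < 2 * r" "j < 2 * r" for i j
    using transfer_prod_fundamental[OF that, of E 0] that by simp
  have edge: "h (int (k + r + 1)) (int (2 * r + k + 1)) = 1" for k
    using h_edge[of "int (k + r + 1)"] by (simp add: algebra_simps)
  \<comment> \<open>This is the block left over when the first \<open>2 * r\<close> coordinates are
    free. The outer edge of the band lies on its diagonal, so it is lower triangular with diagonal
    entries -1.\<close>
  let ?L = "Matrix.mat n n (\<lambda>(k, l). equation E k (2 * r + l))"
  have "Determinant.det ?L = prod_list (diag_mat ?L)"
    by (rule det_lower_triangular[of n]) (auto simp: equation_def h_band)
  also have "\<dots> = (\<Prod>k = 0..<n. - 1)"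
    unfolding prod_list_diag_prod
    using edge r_pos by (intro prod.cong) (auto simp: equation_def simp del: of_nat_add)
  finally have L: "cmod (Determinant.det ?L) = 1" by (simp add: norm_power)
  have "cmod (Determinant.det (submatrix (transfer_prod E n) I J))
      = cmod (Determinant.det (Matrix.mat (2 * r) (2 * r) (\<lambda>(i, j). fundamental E (?s i) j)))"
    by (rule cmod_det_submatrix[OF transfer_prod_carrier I J])
      (auto simp: init transfer_prod_fundamental)
  also have "\<dots> = cmod (Determinant.det (Matrix.mat (2 * r + n) (2 * r + n)
      (\<lambda>(i, j). if i < 2 * r then of_bool (j = ?s i) else equation E (i - 2 * r) j)))"
    using cmod_det_solution_rows[of "\<lambda>x. x" "2 * r" n ?s "fundamental E" "equation E"]
      s init equation_fundamental L by (simp add: bij_betw_def)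
  also have "\<dots> = cmod (Determinant.det (Matrix.mat (2 * r) (2 * r) (\<lambda>(i, j). X (?s i) j)))
      * cmod (Determinant.det (Matrix.mat n n (\<lambda>(k, l). equation E k (boundary_first n (2 * r + l)))))"
    by (rule cmod_det_solution_rows[OF boundary_first_bij s Xc eqX])
  also have "Matrix.mat n n (\<lambda>(k, l). equation E k (boundary_first n (2 * r + l))) = shifted E n"
    by (rule eq_matI) (use shifted_carrier[of E n] in \<open>auto simp: shifted_equation simp del: shifted_carrier\<close>)
  finally show ?thesis .
qed

lemma cmod_minor_le:
  assumes "Im E \<noteq> 0" "I \<subseteq> {..<2 * r}" "card I = r" "J \<subseteq> {..<2 * r}" "card J = r"
  shows "cmod (Determinant.det (submatrix (transfer_prod E n) I J))
    \<le> fact (2 * r) * boundary_bound E ^ (2 * r) * cmod (Determinant.det (shifted E n))"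
proof -
  obtain X where X:
    "\<forall>i<2 * r. \<forall>j<2 * r. X (boundary_first n i) j = of_bool (i = j)"
    "\<forall>k<n. \<forall>j<2 * r. (\<Sum>l<2 * r + n. equation E k l * X l j) = 0"
    "\<forall>l<2 * r + n. \<forall>j<2 * r. cmod (X l j) \<le> boundary_bound E"
    using boundary_solution[OF assms(1), of n] by blast
  note s = minor_rows_less[OF assms(2-5), of _ n]
  show ?thesis
    by (subst cmod_minor[where X = X, OF assms(2-5)])
      (use X s in \<open>auto intro!: mult_right_mono cmod_det_le\<close>)
qed

text \<open>For this pair of index sets the functionals read a solution at the first and last
  \<open>r\<close> coordinates, which are exactly the coordinates at which \<open>X\<close> is
  normalised. The boundary factor is an identity matrix, so that a lower bound for the exterior
  power comes without any estimate.\<close>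

lemma cmod_corner_minor:
  assumes "Im E \<noteq> 0"
  shows "cmod (Determinant.det (submatrix (transfer_prod E n) {r..<2 * r} {r..<2 * r}))
    = cmod (Determinant.det (shifted E n))"
proof -
  obtain X where X:
    "\<forall>i<2 * r. \<forall>j<2 * r. X (boundary_first n i) j = of_bool (i = j)"
    "\<forall>k<n. \<forall>j<2 * r. (\<Sum>l<2 * r + n. equation E k l * X l j) = 0"
    using boundary_solution[OF assms, of n] by blast
  have "pick ({..<2 * r} - {r..<2 * r}) i = i" if "i < r" for i
  proof -
    have "{a \<in> {..<2 * r} - {r..<2 * r}. a < i} = {..<i}" using that by auto
    then show ?thesis using pick_card_in_set[of i "{..<2 * r} - {r..<2 * r}"] that by auto
  qed
  moreover have "pick {r..<2 * r} (i - r) = i" if "r \<le> i" "i < 2 * r" for i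
  proof -
    have "{a \<in> {r..<2 * r}. a < i} = {r..<i}" using that by auto
    then show ?thesis using pick_card_in_set[of i "{r..<2 * r}"] that by auto
  qed
  ultimately have "minor_rows r n {r..<2 * r} {r..<2 * r} i = boundary_first n i" if "i < 2 * r" for i
    using that by (auto simp: minor_rows_def boundary_first_def)
  then have "Matrix.mat (2 * r) (2 * r) (\<lambda>(i, j). X (minor_rows r n {r..<2 * r} {r..<2 * r} i) j) = 1\<^sub>m (2 * r)"
    by (intro eq_matI) (auto simp: X(1))
  then show ?thesis
    using cmod_minor[of "{r..<2 * r}" "{r..<2 * r}" X n E] X by (auto simp: subset_iff)
qed

end

section \<open>Spectra of truncations\<close>

definition mat_tr :: "'a :: comm_ring_1 mat \<Rightarrow> 'a" where
  "mat_tr A = (\<Sum>i<dim_row A. A $$ (i, i))"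

lemma mat_tr_mult_comm:
  assumes "A \<in> carrier_mat n n" "B \<in> carrier_mat n n"
  shows "mat_tr (A * B) = mat_tr (B * A)"
proof -
  have *: "mat_tr (X * Y) = (\<Sum>i<n. \<Sum>l<n. X $$ (i, l) * Y $$ (l, i))"
    if "X \<in> carrier_mat n n" "Y \<in> carrier_mat n n" for X Y :: "'a mat"
    using that by (auto simp: mat_tr_def scalar_prod_def atLeast0LessThan intro!: sum.cong)
  show ?thesis
    unfolding *[OF assms] *[OF assms(2,1)] by (subst sum.swap) (simp add: mult.commute)
qed

lemma upper_triangular_pow:
  fixes B :: "'a :: comm_ring_1 mat"
  assumes B: "B \<in> carrier_mat n n" and ut: "upper_triangular B"
  shows "upper_triangular (B ^\<^sub>m k) \<and> (\<forall>i<n. (B ^\<^sub>m k) $$ (i, i) = (B $$ (i, i)) ^ k)"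
proof (induction k)
  case 0
  then show ?case using B by auto
next
  case (Suc k)
  have Bk: "B ^\<^sub>m k \<in> carrier_mat n n" using B by simp
  have eq: "(B ^\<^sub>m Suc k) $$ (i, j) = (\<Sum>l<n. (B ^\<^sub>m k) $$ (i, l) * B $$ (l, j))" if "i < n" "j < n" for i j
    using that B Bk by (auto simp: scalar_prod_def atLeast0LessThan intro!: sum.cong)
  have z: "(B ^\<^sub>m k) $$ (i, l) * B $$ (l, j) = 0" if "i < n" "l < n" "j < i \<or> j = i \<and> l \<noteq> i" for i l j
  proof (cases "l < i")
    case True
    then have "(B ^\<^sub>m k) $$ (i, l) = 0"
      using Suc.IH Bk that(1) by (intro upper_triangularD) auto
    then show ?thesis by simp
  next
    case False
    then have "B $$ (l, j) = 0"
      using ut B that by (intro upper_triangularD) auto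
    then show ?thesis by simp
  qed
  have "(B ^\<^sub>m Suc k) $$ (i, j) = 0" if "j < i" "i < n" for i j
    using that by (simp only: eq) (auto intro!: sum.neutral z)
  moreover have "(B ^\<^sub>m Suc k) $$ (i, i) = (B $$ (i, i)) ^ Suc k" if "i < n" for i
  proof -
    have "(B ^\<^sub>m Suc k) $$ (i, i) = (\<Sum>l\<in>{i}. (B ^\<^sub>m k) $$ (i, l) * B $$ (l, i))"
      unfolding eq[OF that that] using that by (intro sum.mono_neutral_right) (auto intro!: z)
    then show ?thesis using Suc.IH that by (simp add: mult.commute)
  qed
  ultimately show ?case using B by (auto intro!: upper_triangularI)
qed

text \<open>In Schur form the matrix is triangular, with the roots of the characteristic polynomial
  on its diagonal, and powers of a triangular matrix raise the diagonal entries to that power.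
  Cyclicity of the trace removes the conjugation.\<close>

lemma mat_tr_pow_eq_sum_eigenvalues:
  fixes A :: "complex mat"
  assumes A: "A \<in> carrier_mat n n" and cp: "char_poly A = (\<Prod>a\<leftarrow>as. [:- a, 1:])"
  shows "mat_tr (A ^\<^sub>m k) = (\<Sum>a\<leftarrow>as. a ^ k)"
proof -
  obtain B P Q where BPQ: "schur_decomposition A as = (B, P, Q)" by (metis prod_cases3)
  from schur_decomposition[OF A cp BPQ] have w: "similar_mat_wit A B P Q"
    and ut: "upper_triangular B" and d: "diag_mat B = as" by auto
  note c = similar_mat_witD2[OF A w]
  have Bk: "B ^\<^sub>m k \<in> carrier_mat n n" using c by simp
  have "mat_tr (A ^\<^sub>m k) = mat_tr ((P * B ^\<^sub>m k) * Q)" by (simp add: similar_mat_wit_pow_id[OF w])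
  also have "\<dots> = mat_tr (Q * (P * B ^\<^sub>m k))"
    by (rule mat_tr_mult_comm[of _ n]) (use c Bk in auto)
  also have "Q * (P * B ^\<^sub>m k) = B ^\<^sub>m k"
    using c Bk assoc_mult_mat[OF c(7,6) Bk] by simp
  also have "mat_tr (B ^\<^sub>m k) = (\<Sum>i<n. (B $$ (i, i)) ^ k)"
    using upper_triangular_pow[OF c(5) ut] Bk by (auto simp: mat_tr_def)
  also have "\<dots> = (\<Sum>a\<leftarrow>as. a ^ k)"
    using c(5) by (simp add: d[symmetric] diag_mat_def o_def interv_sum_list_conv_sum_set_nat atLeast0LessThan)
  finally show ?thesis .
qed

section \<open>Averages of periodic sequences\<close>

lemma sum_periodic_shift:
  fixes g :: "nat \<Rightarrow> 'a :: ab_group_add"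
  assumes "\<And>i. g (i + P) = g i"
  shows "(\<Sum>i<P. g (i + s)) = (\<Sum>i<P. g i)"
proof (induction s)
  case (Suc s)
  have "(\<Sum>i<P. g (i + Suc s)) = (\<Sum>i<Suc P. g (i + s)) - g s"
    by (subst sum.lessThan_Suc_shift) simp
  also have "\<dots> = (\<Sum>i<P. g (i + s))"
    using assms[of s] by (simp add: add.commute)
  finally show ?case using Suc by simp
qed simp

text \<open>Full periods contribute exactly their share. The remaining fewer than \<open>P\<close>
  terms and the missing fraction of a period each cost at most \<open>P * K\<close>, so the partial
  sums stay within a bounded distance of linear growth.\<close>

lemma periodic_average_tendsto:
  fixes g :: "nat \<Rightarrow> real"
  assumes per: "\<And>i. g (i + P) = g i" and P: "0 < P" and bnd: "\<And>i. \<bar>g i\<bar> \<le> K"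
  shows "(\<lambda>n. (\<Sum>i<n. g i) / real n) \<longlonglongrightarrow> (\<Sum>i<P. g i) / real P"
proof -
  let ?S = "\<Sum>i<P. g i"
  have K: "K \<ge> 0" using bnd[of 0] by linarith
  have perm: "g (q * P + i) = g i" for q i
  proof (induction q)
    case (Suc q)
    then show ?case using per[of "q * P + i"] by (simp add: ac_simps)
  qed simp
  have mult: "(\<Sum>i<q * P. g i) = real q * ?S" for q
  proof (induction q)
    case (Suc q)
    have "(\<Sum>i<Suc q * P. g i) = (\<Sum>i<q * P. g i) + (\<Sum>i<P. g (q * P + i))"
      unfolding sum_lessThan_add[symmetric] by (simp add: add.commute)
    also have "\<dots> = real q * ?S + ?S" unfolding Suc by (simp only: perm)
    finally show ?case by (simp add: distrib_right)
  qed simp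
  have b: "\<bar>(\<Sum>i<n. g i) - real n * (?S / real P)\<bar> \<le> 2 * (real P * K)" for n
  proof -
    define q t where "q = n div P" and "t = n mod P"
    have n: "n = q * P + t" and t: "t < P" using P by (auto simp: q_def t_def)
    have "(\<Sum>i<n. g i) = real q * ?S + (\<Sum>i<t. g i)"
      unfolding n sum_lessThan_add mult by (simp only: perm)
    then have eq: "(\<Sum>i<n. g i) - real n * (?S / real P) = (\<Sum>i<t. g i) - real t * ?S / real P"
      using P by (simp add: n field_simps)
    have "\<bar>\<Sum>i<t. g i\<bar> \<le> real P * K"
    proof -
      have "\<bar>\<Sum>i<t. g i\<bar> \<le> real t * K"
        using sum_bounded_above[of "{..<t}" "\<lambda>i. \<bar>g i\<bar>" K] bnd
        by (intro order_trans[OF sum_abs]) auto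
      also have "\<dots> \<le> real P * K" using t K by (intro mult_right_mono) auto
      finally show ?thesis .
    qed
    moreover have "\<bar>real t * ?S / real P\<bar> \<le> real P * K"
    proof -
      have "\<bar>?S\<bar> \<le> real P * K"
        using sum_bounded_above[of "{..<P}" "\<lambda>i. \<bar>g i\<bar>" K] bnd
        by (intro order_trans[OF sum_abs]) auto
      moreover have "real t / real P \<le> 1" using t by simp
      ultimately have "(real t / real P) * \<bar>?S\<bar> \<le> 1 * (real P * K)"
        by (intro mult_mono) auto
      then show ?thesis by (simp add: abs_mult)
    qed
    ultimately have "\<bar>\<Sum>i<t. g i\<bar> + \<bar>real t * ?S / real P\<bar> \<le> 2 * (real P * K)"
      unfolding mult_2 by (rule add_mono)
    then show ?thesis
      unfolding eq by (rule order_trans[OF abs_triangle_ineq4])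
  qed
  have "(\<lambda>n. (\<Sum>i<n. g i) / real n - ?S / real P) \<longlonglongrightarrow> 0"
  proof (rule Lim_null_comparison)
    show "\<forall>\<^sub>F n in sequentially. norm ((\<Sum>i<n. g i) / real n - ?S / real P) \<le> 2 * (real P * K) / real n"
    proof (rule eventually_mono[OF eventually_gt_at_top[of 0]])
      fix n :: nat assume "0 < n"
      then have "(\<Sum>i<n. g i) / real n - ?S / real P = ((\<Sum>i<n. g i) - real n * (?S / real P)) / real n"
        by (simp add: field_simps)
      then show "norm ((\<Sum>i<n. g i) / real n - ?S / real P) \<le> 2 * (real P * K) / real n"
        using b[of n] by (simp add: abs_divide divide_right_mono)
    qed
    show "(\<lambda>n. 2 * (real P * K) / real n) \<longlonglongrightarrow> 0"
      by (rule lim_const_over_n)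
  qed
  then show ?thesis by (simp add: LIM_zero_iff)
qed

section \<open>Powers, traces and eigenvalues of the truncations\<close>

context banded
begin

text \<open>A bound for the absolute row sums, a row of the band having \<open>2 * r + 1\<close>
  entries. It controls the entries of powers as well as the eigenvalues.\<close>

definition spectral_bound :: real where
  "spectral_bound = real (2 * r + 1) * C"

text \<open>The kernel of the \<open>k\<close>-th power of the infinite matrix \<open>h\<close>; the
  band condition makes the matrix product a finite sum.\<close>

primrec band_power :: "nat \<Rightarrow> int \<Rightarrow> int \<Rightarrow> real" where
  "band_power 0 a b = of_bool (a = b)"
| "band_power (Suc k) a b = (\<Sum>c\<in>{a - int r..a + int r}. h a c * band_power k c b)"

lemma C_nonneg: "0 \<le> C"
  using h_bound[of 0 0] by linarith

lemma spectral_bound_nonneg: "0 \<le> spectral_bound"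
  by (simp add: spectral_bound_def C_nonneg)

lemma band_power_zero: "\<bar>a - b\<bar> > int (k * r) \<Longrightarrow> band_power k a b = 0"
proof (induction k arbitrary: a)
  case (Suc k)
  have "band_power k c b = 0" if "c \<in> {a - int r..a + int r}" for c
    by (rule Suc.IH) (use that Suc.prems in auto)
  then show ?case by simp
qed auto

lemma band_power_bound: "\<bar>band_power k a b\<bar> \<le> spectral_bound ^ k"
proof (induction k arbitrary: a)
  case (Suc k)
  have "\<bar>band_power (Suc k) a b\<bar> \<le> (\<Sum>c\<in>{a - int r..a + int r}. \<bar>h a c * band_power k c b\<bar>)"
    unfolding band_power.simps by (rule sum_abs)
  also have "\<dots> \<le> (\<Sum>c\<in>{a - int r..a + int r}. C * spectral_bound ^ k)"
    unfolding abs_mult by (intro sum_mono mult_mono h_bound Suc.IH) (auto simp: C_nonneg)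
  also have "\<dots> = spectral_bound ^ Suc k"
    by (simp add: spectral_bound_def nat_add_distrib)
  finally show ?case .
qed simp

lemma band_power_periodic: "band_power k (a + int P) (b + int P) = band_power k a b"
proof (induction k arbitrary: a)
  case (Suc k)
  have "band_power (Suc k) (a + int P) (b + int P)
      = (\<Sum>c\<in>{a - int r..a + int r}. h (a + int P) (c + int P) * band_power k (c + int P) (b + int P))"
    unfolding band_power.simps
    by (rule sum.reindex_bij_witness[of _ "\<lambda>c. c + int P" "\<lambda>c. c - int P"]) auto
  also have "\<dots> = band_power (Suc k) a b"
    by (simp add: Suc.IH h_periodic)
  finally show ?case .
qed simp

definition truncation_mat :: "nat \<Rightarrow> complex mat" where
  "truncation_mat n = Matrix.mat n n (\<lambda>(k, l). of_real (truncation n k l))"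

lemma truncation_mat_carrier [simp]: "truncation_mat n \<in> carrier_mat n n"
  by (simp add: truncation_mat_def)

lemma truncation_row_sum: "(\<Sum>l<n. \<bar>truncation n k l\<bar>) \<le> spectral_bound"
proof -
  have "(\<Sum>l<n. \<bar>truncation n k l\<bar>) = (\<Sum>l\<in>{..<n} \<inter> {k - r..k + r}. \<bar>truncation n k l\<bar>)"
  proof (rule sum.mono_neutral_right)
    show "\<forall>l\<in>{..<n} - {..<n} \<inter> {k - r..k + r}. \<bar>truncation n k l\<bar> = 0"
    proof
      fix l assume "l \<in> {..<n} - {..<n} \<inter> {k - r..k + r}"
      then show "\<bar>truncation n k l\<bar> = 0"
        unfolding truncation_def by (subst h_band) auto
    qed
  qed auto
  also have "\<dots> \<le> real (card ({..<n} \<inter> {k - r..k + r})) * C"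
    by (intro sum_bounded_above) (auto simp: truncation_def h_bound)
  also have "\<dots> \<le> real (2 * r + 1) * C"
  proof (intro mult_right_mono C_nonneg)
    have "card ({..<n} \<inter> {k - r..k + r}) \<le> card {k - r..k + r}" by (rule card_mono) auto
    then show "real (card ({..<n} \<inter> {k - r..k + r})) \<le> real (2 * r + 1)" by simp
  qed
  finally show ?thesis by (simp add: spectral_bound_def)
qed

lemma truncation_mat_pow_Suc_index:
  assumes "i < n" "j < n"
  shows "(truncation_mat n ^\<^sub>m Suc k) $$ (i, j)
    = (\<Sum>l<n. of_real (truncation n i l) * (truncation_mat n ^\<^sub>m k) $$ (l, j))"
proof -
  let ?A = "truncation_mat n"
  have A: "?A \<in> carrier_mat n n" "\<And>k. ?A ^\<^sub>m k \<in> carrier_mat n n"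
    by (auto simp: truncation_mat_def)
  \<comment> \<open>Matrix powers are defined by multiplication on the right, whereas the recursion
    of \<open>band_power\<close> multiplies on the left.\<close>
  have "?A ^\<^sub>m Suc k = ?A * ?A ^\<^sub>m k"
  proof (induction k)
    case (Suc k)
    have "?A ^\<^sub>m Suc (Suc k) = (?A * ?A ^\<^sub>m k) * ?A" using Suc by simp
    also have "\<dots> = ?A * ?A ^\<^sub>m Suc k" using assoc_mult_mat[OF A(1) A(2)[of k] A(1)] by simp
    finally show ?case .
  qed (simp only: pow_mat.simps carrier_matD(1)[OF A(1)] left_mult_one_mat[OF A(1)]
      right_mult_one_mat[OF A(1)])
  then show ?thesis
    using assms A(2)[of k]
    by (auto simp: scalar_prod_def atLeast0LessThan truncation_mat_def intro!: sum.cong)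
qed

lemma truncation_mat_pow_bound:
  assumes "i < n" "j < n"
  shows "cmod ((truncation_mat n ^\<^sub>m k) $$ (i, j)) \<le> spectral_bound ^ k"
  using assms(1)
proof (induction k arbitrary: i)
  case 0
  then show ?case using assms by (simp add: truncation_mat_def)
next
  case (Suc k)
  have "cmod ((truncation_mat n ^\<^sub>m Suc k) $$ (i, j))
      \<le> (\<Sum>l<n. \<bar>truncation n i l\<bar> * cmod ((truncation_mat n ^\<^sub>m k) $$ (l, j)))"
    unfolding truncation_mat_pow_Suc_index[OF Suc.prems assms(2)]
    by (rule order_trans[OF norm_sum]) (simp add: norm_mult)
  also have "\<dots> \<le> (\<Sum>l<n. \<bar>truncation n i l\<bar> * spectral_bound ^ k)"
    by (intro sum_mono mult_left_mono Suc.IH) auto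
  also have "\<dots> \<le> spectral_bound * spectral_bound ^ k"
    unfolding sum_distrib_right[symmetric]
    by (intro mult_right_mono truncation_row_sum) (simp add: spectral_bound_nonneg)
  finally show ?case by simp
qed

text \<open>A path of \<open>k\<close> steps of length at most \<open>r\<close> ending in a column
  that far from both ends never leaves the interval, so truncating changes nothing. Only the column
  is restricted; this leaves the row free to vary in the induction.\<close>

lemma truncation_mat_pow_interior:
  assumes "k * r \<le> j" "j + k * r < n" "i < n"
  shows "(truncation_mat n ^\<^sub>m k) $$ (i, j) = of_real (band_power k (int (i + r + 1)) (int (j + r + 1)))"
  using assms
proof (induction k arbitrary: i)
  case 0
  then show ?case by (simp add: truncation_mat_def)
next
  case (Suc k)
  let ?i = "int (i + r + 1)" and ?j = "int (j + r + 1)"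
  have "(\<Sum>l<n. truncation n i l * band_power k (int (l + r + 1)) ?j)
      = (\<Sum>c\<in>(\<lambda>l. int (l + r + 1)) ` {..<n}. h ?i c * band_power k c ?j)"
    by (subst sum.reindex) (auto simp: inj_on_def truncation_def)
  also have "\<dots> = (\<Sum>c\<in>{?i - int r..?i + int r}. h ?i c * band_power k c ?j)"
  proof (rule sum.mono_neutral_cong)
    fix c assume c: "c \<in> (\<lambda>l. int (l + r + 1)) ` {..<n} - {?i - int r..?i + int r}"
    then show "h ?i c * band_power k c ?j = 0" by (subst h_band) auto
  next
    \<comment> \<open>A site outside the interval is more than \<open>k * r\<close> away from the
      site of the column, where the remaining power vanishes.\<close>
    fix c assume c: "c \<in> {?i - int r..?i + int r} - (\<lambda>l. int (l + r + 1)) ` {..<n}"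
    have "c < int (r + 1) \<or> c \<ge> int (n + r + 1)"
    proof (rule ccontr)
      assume *: "\<not> ?thesis"
      then have "c = int (nat (c - int (r + 1)) + r + 1)" "nat (c - int (r + 1)) < n" by auto
      then show False using c by blast
    qed
    moreover obtain m where m: "k * r = m" by blast
    moreover have "r + m \<le> j" "j + (r + m) < n" using Suc.prems(1,2) m by auto
    ultimately have "\<bar>c - ?j\<bar> > int (k * r)"
      unfolding m using r_pos by linarith
    then show "h ?i c * band_power k c ?j = 0" by (simp add: band_power_zero)
  qed auto
  finally have "of_real (band_power (Suc k) ?i ?j)
      = (\<Sum>l<n. of_real (truncation n i l) * of_real (band_power k (int (l + r + 1)) ?j) :: complex)"
    by (metis (no_types, lifting) band_power.simps(2) of_real_sum of_real_mult sum.cong)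
  also have "\<dots> = (truncation_mat n ^\<^sub>m Suc k) $$ (i, j)"
    using Suc.prems by (subst truncation_mat_pow_Suc_index) (auto simp: Suc.IH)
  finally show ?case by simp
qed

text \<open>The diagonal of the \<open>k\<close>-th power averaged over a period; it will be the
  \<open>k\<close>-th moment of the density of states.\<close>

definition moment :: "nat \<Rightarrow> real" where
  "moment k = (\<Sum>i<P. band_power k (int i) (int i)) / real P"

lemma trace_average_tendsto:
  "(\<lambda>n. Re (mat_tr (truncation_mat n ^\<^sub>m k)) / real n) \<longlonglongrightarrow> moment k"
proof -
  define g where "g i = band_power k (int i) (int i)" for i
  \<comment> \<open>Index \<open>i\<close> of a truncation is the site \<open>i + r + 1\<close>.
    Shifting does not change the sum over a period.\<close>
  define g' where "g' i = g (i + (r + 1))" for i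
  let ?t = "\<lambda>n i. Re ((truncation_mat n ^\<^sub>m k) $$ (i, i))"
  have per: "g (i + P) = g i" for i using band_power_periodic[of k "int i" "int i"] by (simp add: g_def)
  have "(\<lambda>n. (\<Sum>i<n. g' i) / real n) \<longlonglongrightarrow> (\<Sum>i<P. g' i) / real P"
  proof (rule periodic_average_tendsto[OF _ P_pos])
    show "g' (i + P) = g' i" for i using per[of "i + (r + 1)"] by (simp add: g'_def ac_simps)
    show "\<bar>g' i\<bar> \<le> spectral_bound ^ k" for i by (simp add: g'_def g_def band_power_bound)
  qed
  also have "(\<Sum>i<P. g' i) = (\<Sum>i<P. g i)"
    unfolding g'_def by (rule sum_periodic_shift[of g P, OF per])
  finally have lim: "(\<lambda>n. (\<Sum>i<n. g' i) / real n) \<longlonglongrightarrow> moment k"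
    by (simp add: moment_def g_def)
  \<comment> \<open>At most \<open>k * r\<close> diagonal entries near each end differ from those of
    the infinite matrix, and each difference is at most twice the bound on entries of the
    power.\<close>
  define K where "K = real (2 * (k * r)) * (2 * spectral_bound ^ k)"
  have b: "\<bar>(\<Sum>i<n. ?t n i) - (\<Sum>i<n. g' i)\<bar> \<le> K" for n
  proof -
    have "\<bar>(\<Sum>i<n. ?t n i) - (\<Sum>i<n. g' i)\<bar> \<le> (\<Sum>i<n. \<bar>?t n i - g' i\<bar>)"
      unfolding sum_subtractf[symmetric] by (rule sum_abs)
    also have "\<dots> = (\<Sum>i\<in>{..<n} \<inter> ({..<k * r} \<union> {n - k * r..<n}). \<bar>?t n i - g' i\<bar>)"
    proof (rule sum.mono_neutral_right)
      show "\<forall>i\<in>{..<n} - {..<n} \<inter> ({..<k * r} \<union> {n - k * r..<n}). \<bar>?t n i - g' i\<bar> = 0"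
      proof
        fix i assume "i \<in> {..<n} - {..<n} \<inter> ({..<k * r} \<union> {n - k * r..<n})"
        then have "k * r \<le> i" "i + k * r < n" "i < n" by auto
        then show "\<bar>?t n i - g' i\<bar> = 0"
          by (simp add: truncation_mat_pow_interior g'_def g_def add.assoc)
      qed
    qed auto
    also have "\<dots> \<le> real (card ({..<n} \<inter> ({..<k * r} \<union> {n - k * r..<n}))) * (2 * spectral_bound ^ k)"
    proof (rule sum_bounded_above)
      fix i assume "i \<in> {..<n} \<inter> ({..<k * r} \<union> {n - k * r..<n})"
      then have "\<bar>?t n i\<bar> \<le> spectral_bound ^ k"
        by (intro order_trans[OF abs_Re_le_cmod] truncation_mat_pow_bound) auto
      moreover have "\<bar>g' i\<bar> \<le> spectral_bound ^ k" by (simp add: g'_def g_def band_power_bound)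
      ultimately show "\<bar>?t n i - g' i\<bar> \<le> 2 * spectral_bound ^ k" by linarith
    qed
    also have "\<dots> \<le> K"
      unfolding K_def
    proof (intro mult_right_mono)
      have "card ({..<n} \<inter> ({..<k * r} \<union> {n - k * r..<n})) \<le> card ({..<k * r} \<union> {n - k * r..<n})"
        by (rule card_mono) auto
      also have "\<dots> \<le> card {..<k * r} + card {n - k * r..<n}" by (rule card_Un_le)
      also have "\<dots> \<le> 2 * (k * r)" by simp
      finally show "real (card ({..<n} \<inter> ({..<k * r} \<union> {n - k * r..<n}))) \<le> real (2 * (k * r))"
        by (simp only: of_nat_le_iff)
    qed (simp add: spectral_bound_nonneg)
    finally show ?thesis .
  qed
  have "(\<lambda>n. (\<Sum>i<n. ?t n i) / real n - (\<Sum>i<n. g' i) / real n) \<longlonglongrightarrow> 0"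
  proof (rule Lim_null_comparison)
    show "\<forall>\<^sub>F n in sequentially. norm ((\<Sum>i<n. ?t n i) / real n - (\<Sum>i<n. g' i) / real n) \<le> K / real n"
      using b by (auto simp: abs_divide divide_right_mono simp flip: diff_divide_distrib)
    show "(\<lambda>n. K / real n) \<longlonglongrightarrow> 0" by (rule lim_const_over_n)
  qed
  from tendsto_add[OF this lim] have "(\<lambda>n. (\<Sum>i<n. ?t n i) / real n) \<longlonglongrightarrow> moment k" by simp
  moreover have "Re (mat_tr (truncation_mat n ^\<^sub>m k)) = (\<Sum>i<n. ?t n i)" for n
    by (simp add: mat_tr_def truncation_mat_def)
  ultimately show ?thesis by simp
qed

lemma truncation_mat_mult_vec:
  assumes "k < n" "v \<in> carrier_vec n"
  shows "(truncation_mat n *\<^sub>v v) $ k = (\<Sum>l<n. of_real (truncation n k l) * v $ l)"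
  using assms by (auto simp: truncation_mat_def scalar_prod_def atLeast0LessThan intro!: sum.cong)

text \<open>The eigenvalue equation is read at a coordinate where the eigenvector has largest
  modulus; the row sum there bounds the eigenvalue.\<close>

lemma eigenvalue_truncation_bound:
  assumes "eigenvalue (truncation_mat n) a"
  shows "cmod a \<le> spectral_bound"
proof -
  obtain v where v: "v \<in> carrier_vec n" "v \<noteq> 0\<^sub>v n" "truncation_mat n *\<^sub>v v = a \<cdot>\<^sub>v v"
    using assms by (auto simp: eigenvalue_def eigenvector_def truncation_mat_def)
  have n: "{..<n} \<noteq> {}"
  proof
    assume "{..<n} = {}"
    then have "n = 0" by auto
    then have "v = 0\<^sub>v n" using v(1) by (intro eq_vecI) auto
    with v(2) show False by contradiction
  qed
  obtain k where k: "k < n" and max: "\<And>l. l < n \<Longrightarrow> cmod (v $ l) \<le> cmod (v $ k)"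
  proof -
    have "Max ((\<lambda>l. cmod (v $ l)) ` {..<n}) \<in> (\<lambda>l. cmod (v $ l)) ` {..<n}"
      using n by (intro Max_in) auto
    then obtain k where k: "k < n" "Max ((\<lambda>l. cmod (v $ l)) ` {..<n}) = cmod (v $ k)"
      by auto
    have "cmod (v $ l) \<le> cmod (v $ k)" if "l < n" for l
      unfolding k(2)[symmetric] using that by (intro Max_ge) auto
    with k(1) show thesis by (rule that)
  qed
  have pos: "cmod (v $ k) > 0"
  proof (rule ccontr)
    assume "\<not> ?thesis"
    then have "v $ l = 0" if "l < n" for l using max[OF that] by simp
    then show False using v by (auto intro: eq_vecI)
  qed
  have "cmod a * cmod (v $ k) \<le> spectral_bound * cmod (v $ k)"
  proof -
    have "cmod a * cmod (v $ k) = cmod ((truncation_mat n *\<^sub>v v) $ k)"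
      using k v by (simp add: norm_mult)
    also have "\<dots> \<le> (\<Sum>l<n. \<bar>truncation n k l\<bar> * cmod (v $ l))"
      unfolding truncation_mat_mult_vec[OF k v(1)]
      by (rule order_trans[OF norm_sum]) (simp add: norm_mult)
    also have "\<dots> \<le> (\<Sum>l<n. \<bar>truncation n k l\<bar> * cmod (v $ k))"
      by (intro sum_mono mult_left_mono max) auto
    also have "\<dots> \<le> spectral_bound * cmod (v $ k)"
      unfolding sum_distrib_right[symmetric] by (intro mult_right_mono truncation_row_sum) auto
    finally show ?thesis .
  qed
  then show ?thesis using pos by (rule mult_right_le_imp_le)
qed

lemma poly_char_poly_truncation: "poly (char_poly (truncation_mat n)) E = Determinant.det (shifted E n)"
proof -
  have "- char_matrix (truncation_mat n) E = shifted E n"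
    by (rule eq_matI) (auto simp: char_matrix_def truncation_mat_def shifted_def)
  then show ?thesis by (simp add: char_poly_matrix[OF truncation_mat_carrier])
qed

text \<open>The roots of the characteristic polynomial give both the determinant and the traces.
  They are real since the determinant of the shifted matrix has no zero off the real axis.\<close>

lemma truncation_spectrum:
  obtains ls :: "real list" where "length ls = n" "\<And>x. x \<in> set ls \<Longrightarrow> \<bar>x\<bar> \<le> spectral_bound"
    "\<And>E. Determinant.det (shifted E n) = (\<Prod>x\<leftarrow>ls. E - of_real x)"
    "\<And>k. Re (mat_tr (truncation_mat n ^\<^sub>m k)) = (\<Sum>x\<leftarrow>ls. x ^ k)"
proof -
  obtain as where cp: "char_poly (truncation_mat n) = (\<Prod>a\<leftarrow>as. [:- a, 1:])" and len: "length as = n"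
    using char_poly_factorized[OF truncation_mat_carrier] by blast
  have det: "Determinant.det (shifted E n) = (\<Prod>a\<leftarrow>as. E - a)" for E
    unfolding poly_char_poly_truncation[symmetric] cp
    by (simp add: poly_prod_list o_def)
  have root: "poly (char_poly (truncation_mat n)) a = 0" if "a \<in> set as" for a
    unfolding poly_char_poly_truncation det using that by (auto simp: prod_list_zero_iff)
  have real: "of_real (Re a) = a" if "a \<in> set as" for a
    using det_shifted_nonzero[of a n] root[OF that]
    by (auto simp: poly_char_poly_truncation complex_eq_iff)
  have bnd: "cmod a \<le> spectral_bound" if "a \<in> set as" for a
    using root[OF that] eigenvalue_root_char_poly[OF truncation_mat_carrier] eigenvalue_truncation_bound
    by blast
  show thesis
  proof (rule that[of "map Re as"])
    show "length (map Re as) = n" by (simp add: len)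
    show "\<bar>x\<bar> \<le> spectral_bound" if "x \<in> set (map Re as)" for x
      using that bnd abs_Re_le_cmod order_trans by fastforce
    show "Determinant.det (shifted E n) = (\<Prod>x\<leftarrow>map Re as. E - of_real x)" for E
      unfolding det by (simp add: o_def real cong: map_cong)
    show "Re (mat_tr (truncation_mat n ^\<^sub>m k)) = (\<Sum>x\<leftarrow>map Re as. x ^ k)" for k
    proof -
      have "(\<Sum>a\<leftarrow>as. a ^ k) = (\<Sum>a\<leftarrow>as. of_real (Re a ^ k))"
        by (intro arg_cong[of _ _ sum_list] map_cong) (auto simp: real)
      also have "\<dots> = of_real (\<Sum>a\<leftarrow>as. Re a ^ k)" by (induction as) auto
      finally show ?thesis
        by (simp add: mat_tr_pow_eq_sum_eigenvalues[OF truncation_mat_carrier cp] o_def)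
    qed
  qed
qed

end

section \<open>Logarithmic asymptotics\<close>

lemma sum_list_abs_diff_le:
  fixes g q :: "'a \<Rightarrow> real"
  assumes "\<And>x. x \<in> set xs \<Longrightarrow> \<bar>g x - q x\<bar> \<le> \<epsilon>"
  shows "\<bar>(\<Sum>x\<leftarrow>xs. g x) - (\<Sum>x\<leftarrow>xs. q x)\<bar> \<le> real (length xs) * \<epsilon>"
  using assms
proof (induction xs)
  case (Cons a xs)
  have "\<bar>g a - q a\<bar> \<le> \<epsilon>" "\<bar>(\<Sum>x\<leftarrow>xs. g x) - (\<Sum>x\<leftarrow>xs. q x)\<bar> \<le> real (length xs) * \<epsilon>"
    using Cons by auto
  then show ?case by (simp add: algebra_simps)
qed simp

lemma integrable_continuous_bounded_support:
  fixes \<nu> :: "real measure" and g :: "real \<Rightarrow> real"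
  assumes "finite_measure \<nu>" "sets \<nu> = sets borel" "AE x in \<nu>. \<bar>x\<bar> \<le> K" "continuous_on UNIV g"
  shows "integrable \<nu> g"
proof -
  have "compact (g ` {-K..K})"
    by (intro compact_continuous_image continuous_on_subset[OF assms(4)]) auto
  then obtain B where B: "\<And>x. x \<in> {-K..K} \<Longrightarrow> norm (g x) \<le> B"
    using bounded_iff compact_imp_bounded by (metis imageI)
  have "g \<in> borel_measurable \<nu>"
    using borel_measurable_continuous_onI[OF assms(4)] assms(2) by (simp cong: measurable_cong_sets)
  moreover have "AE x in \<nu>. norm (g x) \<le> B"
    using assms(3) by eventually_elim (intro B, auto)
  ultimately show ?thesis
    using finite_measure.integrable_const_bound[OF assms(1)] by blast
qed

text \<open>On the interval of radius \<open>K\<close> a polynomial uniformly close to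
  \<open>g\<close> replaces it both under the averages and under the integral; for the polynomial,
  convergence is linear in the moments.\<close>

lemma moments_tendsto_imp_weak_tendsto:
  fixes xs :: "nat \<Rightarrow> real list" and \<nu> :: "real measure" and g :: "real \<Rightarrow> real"
  assumes fin: "finite_measure \<nu>" and sets: "sets \<nu> = sets borel" and AE: "AE x in \<nu>. \<bar>x\<bar> \<le> K"
    and len: "\<And>n. length (xs n) = n" and bnd: "\<And>n x. x \<in> set (xs n) \<Longrightarrow> \<bar>x\<bar> \<le> K"
    and lim: "\<And>k. (\<lambda>n. (\<Sum>x\<leftarrow>xs n. x ^ k) / real n) \<longlonglongrightarrow> (\<integral>x. x ^ k \<partial>\<nu>)"
    and g: "continuous_on UNIV g"
  shows "(\<lambda>n. (\<Sum>x\<leftarrow>xs n. g x) / real n) \<longlonglongrightarrow> (\<integral>x. g x \<partial>\<nu>)"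
proof (rule LIMSEQ_I)
  note int = integrable_continuous_bounded_support[OF fin sets AE]
  \<comment> \<open>The zeroth moment forces total mass 1. At \<open>n = 0\<close> the quotient is
    0, hence the detour through an eventual equality.\<close>
  have "(\<lambda>n. real n / real n) \<longlonglongrightarrow> 1"
    by (rule tendsto_eventually) (auto intro: eventually_mono[OF eventually_gt_at_top[of 0]])
  moreover have "(\<lambda>n. real n / real n) \<longlonglongrightarrow> measure \<nu> (space \<nu>)"
    using lim[of 0] len by (simp add: sum_list_triv)
  ultimately have mass: "measure \<nu> (space \<nu>) = 1" using LIMSEQ_unique by blast
  fix \<epsilon> :: real assume \<epsilon>: "0 < \<epsilon>"
  \<comment> \<open>Three errors arise: exchanging \<open>g\<close> for \<open>q\<close> in the
    average, convergence for \<open>q\<close>, and the exchange back in the integral. A quarter of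
    the tolerance for each leaves room for a strict inequality.\<close>
  obtain q where "real_polynomial_function q" and q: "\<And>x. x \<in> {-K..K} \<Longrightarrow> \<bar>g x - q x\<bar> < \<epsilon> / 4"
  proof (rule Stone_Weierstrass_real_polynomial_function[of "{-K..K}" g "\<epsilon> / 4"])
    show "continuous_on {-K..K} g" by (rule continuous_on_subset[OF g subset_UNIV])
  qed (use \<epsilon> in auto)
  then obtain a d where qa: "q = (\<lambda>x. \<Sum>i\<le>d. a i * x ^ i)"
    using real_polynomial_function_iff_sum by blast
  have qc: "continuous_on UNIV q" unfolding qa by (intro continuous_intros)
  have "(\<lambda>n. \<Sum>i\<le>d. a i * ((\<Sum>x\<leftarrow>xs n. x ^ i) / real n)) \<longlonglongrightarrow> (\<Sum>i\<le>d. a i * (\<integral>x. x ^ i \<partial>\<nu>))"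
    by (intro tendsto_intros lim)
  moreover have "(\<Sum>i\<le>d. a i * ((\<Sum>x\<leftarrow>xs n. x ^ i) / real n)) = (\<Sum>x\<leftarrow>xs n. q x) / real n" for n
  proof -
    have "(\<Sum>x\<leftarrow>ys. q x) = (\<Sum>i\<le>d. a i * (\<Sum>x\<leftarrow>ys. x ^ i))" for ys
      by (induction ys) (simp_all add: qa sum.distrib distrib_left)
    then show ?thesis by (simp add: sum_divide_distrib)
  qed
  moreover have "(\<Sum>i\<le>d. a i * (\<integral>x. x ^ i \<partial>\<nu>)) = (\<integral>x. q x \<partial>\<nu>)"
  proof -
    have i: "integrable \<nu> (\<lambda>x. a i * x ^ i)" for i by (intro int continuous_intros)
    have "(\<integral>x. (\<Sum>i\<le>d. a i * x ^ i) \<partial>\<nu>) = (\<Sum>i\<le>d. \<integral>x. a i * x ^ i \<partial>\<nu>)"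
      by (rule Bochner_Integration.integral_sum) (rule i)
    then show ?thesis by (simp add: qa)
  qed
  ultimately have "(\<lambda>n. (\<Sum>x\<leftarrow>xs n. q x) / real n) \<longlonglongrightarrow> (\<integral>x. q x \<partial>\<nu>)" by simp
  from LIMSEQ_D[OF this, of "\<epsilon> / 4"] \<epsilon> obtain N where
    N: "\<And>n. n \<ge> N \<Longrightarrow> \<bar>(\<Sum>x\<leftarrow>xs n. q x) / real n - (\<integral>x. q x \<partial>\<nu>)\<bar> < \<epsilon> / 4" by auto
  have "\<bar>(\<integral>x. g x \<partial>\<nu>) - (\<integral>x. q x \<partial>\<nu>)\<bar> = \<bar>\<integral>x. g x - q x \<partial>\<nu>\<bar>"
    by (simp add: Bochner_Integration.integral_diff int g qc)
  also have "\<dots> \<le> (\<integral>x. \<bar>g x - q x\<bar> \<partial>\<nu>)" by (rule integral_abs_bound)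
  also have "\<dots> \<le> (\<integral>x. \<epsilon> / 4 \<partial>\<nu>)"
  proof (rule integral_mono_AE)
    show "integrable \<nu> (\<lambda>x. \<bar>g x - q x\<bar>)" by (intro int continuous_intros g qc)
    show "integrable \<nu> (\<lambda>x. \<epsilon> / 4)" by (intro int continuous_intros)
    show "AE x in \<nu>. \<bar>g x - q x\<bar> \<le> \<epsilon> / 4"
      using AE by eventually_elim (intro less_imp_le[OF q], auto)
  qed
  also have "\<dots> = \<epsilon> / 4" using mass by simp
  finally have I: "\<bar>(\<integral>x. g x \<partial>\<nu>) - (\<integral>x. q x \<partial>\<nu>)\<bar> \<le> \<epsilon> / 4" .
  show "\<exists>no. \<forall>n\<ge>no. norm ((\<Sum>x\<leftarrow>xs n. g x) / real n - (\<integral>x. g x \<partial>\<nu>)) < \<epsilon>"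
  proof (intro exI[of _ "max N 1"] allI impI)
    fix n assume n: "max N 1 \<le> n"
    have "\<bar>g x - q x\<bar> \<le> \<epsilon> / 4" if "x \<in> set (xs n)" for x
      using bnd[OF that] by (intro less_imp_le[OF q]) auto
    then have "\<bar>(\<Sum>x\<leftarrow>xs n. g x) - (\<Sum>x\<leftarrow>xs n. q x)\<bar> \<le> real n * (\<epsilon> / 4)"
      using sum_list_abs_diff_le[of "xs n" g q "\<epsilon> / 4"] by (simp only: len)
    then have "\<bar>(\<Sum>x\<leftarrow>xs n. g x) - (\<Sum>x\<leftarrow>xs n. q x)\<bar> / real n \<le> \<epsilon> / 4"
      using n by (simp add: field_simps)
    then have "\<bar>(\<Sum>x\<leftarrow>xs n. g x) / real n - (\<Sum>x\<leftarrow>xs n. q x) / real n\<bar> \<le> \<epsilon> / 4"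
      by (simp add: abs_divide flip: diff_divide_distrib)
    with N[of n] n I \<epsilon> show "norm ((\<Sum>x\<leftarrow>xs n. g x) / real n - (\<integral>x. g x \<partial>\<nu>)) < \<epsilon>"
      unfolding real_norm_def by linarith
  qed
qed

section \<open>Operator norms and the exterior power of order zero\<close>

lemma l2_operator_norm_bounds:
  assumes I: "finite I" and J: "finite J" and le: "\<And>i j. i \<in> I \<Longrightarrow> j \<in> J \<Longrightarrow> cmod (M i j) \<le> K"
  shows "l2_operator_norm I J M \<le> real (card I) * (real (card J) * K)"
    and "i \<in> I \<Longrightarrow> j \<in> J \<Longrightarrow> cmod (M i j) \<le> l2_operator_norm I J M"
proof -
  let ?f = "\<lambda>x. L2_set (\<lambda>i. cmod (\<Sum>j\<in>J. M i j * x j)) I"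
  let ?X = "{x :: _ \<Rightarrow> complex. L2_set (\<lambda>j. cmod (x j)) J \<le> 1}"
  have ub: "?f x \<le> real (card I) * (real (card J) * K)" if "x \<in> ?X" for x
  proof -
    have x1: "cmod (x j) \<le> 1" if "j \<in> J" for j
      using member_le_L2_set[OF J that, of "\<lambda>j. cmod (x j)"] \<open>x \<in> ?X\<close> by simp
    have "?f x \<le> (\<Sum>i\<in>I. cmod (\<Sum>j\<in>J. M i j * x j))"
      by (intro L2_set_le_sum) auto
    also have "\<dots> \<le> (\<Sum>i\<in>I. real (card J) * K)"
    proof (rule sum_mono)
      fix i assume i: "i \<in> I"
      have "cmod (\<Sum>j\<in>J. M i j * x j) \<le> (\<Sum>j\<in>J. cmod (M i j) * cmod (x j))"
        by (rule order_trans[OF norm_sum]) (simp add: norm_mult)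
      also have "\<dots> \<le> (\<Sum>j\<in>J. K * 1)"
        using i by (intro sum_mono mult_mono le x1) (auto intro: order_trans[OF norm_ge_zero le])
      finally show "cmod (\<Sum>j\<in>J. M i j * x j) \<le> real (card J) * K" by simp
    qed
    finally show ?thesis by simp
  qed
  have "(\<lambda>_. 0) \<in> ?X" by (simp add: L2_set_def)
  then have "?X \<noteq> {}" by (metis empty_iff)
  then show "l2_operator_norm I J M \<le> real (card I) * (real (card J) * K)"
    unfolding l2_operator_norm_def by (rule cSUP_least) (rule ub)
  assume i: "i \<in> I" and j: "j \<in> J"
  \<comment> \<open>A unit coordinate vector as test vector isolates column
    \<open>j\<close>.\<close>
  define x where "x j' = (of_bool (j' = j) :: complex)" for j'
  have "x \<in> ?X"
  proof -
    have "(\<Sum>j'\<in>J. (cmod (x j'))\<^sup>2) = (\<Sum>j'\<in>J. of_bool (j' = j) * 1)"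
      by (intro sum.cong) (auto simp: x_def)
    also have "\<dots> = 1" using J j by (intro sum_of_bool_mult)
    finally show ?thesis by (simp add: L2_set_def)
  qed
  have "cmod (M i j) = cmod (\<Sum>j'\<in>J. M i j' * x j')"
    using sum_of_bool_mult(2)[OF J j, of "M i"] by (simp add: x_def)
  also have "\<dots> \<le> ?f x"
    using member_le_L2_set[OF I i, of "\<lambda>i. cmod (\<Sum>j\<in>J. M i j * x j)"] by simp
  also have "\<dots> \<le> l2_operator_norm I J M"
    unfolding l2_operator_norm_def using \<open>x \<in> ?X\<close> ub by (intro cSUP_upper bdd_aboveI2) auto
  finally show "cmod (M i j) \<le> l2_operator_norm I J M" .
qed

text \<open>The empty set is the only index set and the empty determinant is 1, so this is the norm
  of the identity in dimension one.\<close>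

lemma exterior_power_norm_0: "exterior_power_norm 0 M = 1"
proof -
  have s: "{I. I \<subseteq> {..<n} \<and> card I = 0} = {{}}" for n :: nat
    by (auto dest: finite_subset)
  have d: "exterior_power_entry M {} {} = 1"
    by (simp add: exterior_power_entry_def submatrix_def det_dim_zero)
  have "l2_operator_norm {{}} {{}} (exterior_power_entry M) \<le> real (card {{} :: nat set}) * (real (card {{} :: nat set}) * 1)"
    by (rule l2_operator_norm_bounds(1)) (auto simp: d)
  moreover have "cmod (exterior_power_entry M {} {}) \<le> l2_operator_norm {{}} {{}} (exterior_power_entry M)"
    by (rule l2_operator_norm_bounds(2)[where K = 1]) (auto simp: d)
  ultimately show ?thesis unfolding exterior_power_norm_def s by (simp add: d)
qed

lemma ln_prod_list:
  assumes "\<And>x. x \<in> set xs \<Longrightarrow> f x > 0"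
  shows "ln (\<Prod>x\<leftarrow>xs. f x) = (\<Sum>x\<leftarrow>xs. ln (f x :: real))"
  using assms
proof (induction xs)
  case (Cons a xs)
  have "(\<Prod>x\<leftarrow>ys. f x) > 0" if "set ys \<subseteq> set xs" for ys
    using that Cons.prems by (induction ys) auto
  then have "(\<Prod>x\<leftarrow>xs. f x) > 0" by blast
  moreover have "f a > 0" using Cons.prems by simp
  ultimately have "ln (f a * (\<Prod>x\<leftarrow>xs. f x)) = ln (f a) + ln (\<Prod>x\<leftarrow>xs. f x)"
    by (simp only: ln_mult_pos)
  then show ?case using Cons by simp
qed simp

section \<open>Asymptotics of Dirichlet determinants and of the exterior power\<close>

context banded
begin

lemma log_det_shifted_tendsto:
  assumes E: "Im E \<noteq> 0" and fin: "finite_measure \<nu>" and sets: "sets \<nu> = sets borel"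
    and AE: "AE x in \<nu>. \<bar>x\<bar> \<le> K" and mom: "\<And>k. (\<integral>x. x ^ k \<partial>\<nu>) = moment k"
  shows "(\<lambda>n. ln (cmod (Determinant.det (shifted E n))) / real n)
    \<longlonglongrightarrow> (\<integral>x. ln (cmod (of_real x - E)) \<partial>\<nu>)"
proof -
  have "\<exists>ls :: real list. length ls = n \<and> (\<forall>x\<in>set ls. \<bar>x\<bar> \<le> spectral_bound) \<and>
      (\<forall>E. Determinant.det (shifted E n) = (\<Prod>x\<leftarrow>ls. E - of_real x)) \<and>
      (\<forall>k. Re (mat_tr (truncation_mat n ^\<^sub>m k)) = (\<Sum>x\<leftarrow>ls. x ^ k))" for n
    by (rule truncation_spectrum[of n]) blast
  then obtain ls :: "nat \<Rightarrow> real list" where len: "\<And>n. length (ls n) = n"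
    and bnd: "\<And>n x. x \<in> set (ls n) \<Longrightarrow> \<bar>x\<bar> \<le> spectral_bound"
    and det: "\<And>n E. Determinant.det (shifted E n) = (\<Prod>x\<leftarrow>ls n. E - of_real x)"
    and tr: "\<And>n k. Re (mat_tr (truncation_mat n ^\<^sub>m k)) = (\<Sum>x\<leftarrow>ls n. x ^ k)"
    by metis
  have ne: "of_real x - E \<noteq> 0" for x using E by (auto simp: complex_eq_iff)
  have "(\<lambda>n. (\<Sum>x\<leftarrow>ls n. ln (cmod (of_real x - E))) / real n)
      \<longlonglongrightarrow> (\<integral>x. ln (cmod (of_real x - E)) \<partial>\<nu>)"
  \<comment> \<open>The larger of the two radii gives one interval containing both the support of
    the measure and all eigenvalues of truncations.\<close>
  proof (rule moments_tendsto_imp_weak_tendsto[where K = "max K spectral_bound"])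
    show "AE x in \<nu>. \<bar>x\<bar> \<le> max K spectral_bound"
      using AE by eventually_elim auto
    show "\<bar>x\<bar> \<le> max K spectral_bound" if "x \<in> set (ls n)" for n x
      using bnd[OF that] by simp
    show "(\<lambda>n. (\<Sum>x\<leftarrow>ls n. x ^ k) / real n) \<longlonglongrightarrow> (\<integral>x. x ^ k \<partial>\<nu>)" for k
      using trace_average_tendsto[of k] by (simp add: tr mom)
    show "continuous_on UNIV (\<lambda>x. ln (cmod (of_real x - E)))"
      using ne by (intro continuous_intros) auto
  qed (fact fin sets len)+
  moreover have "(\<Sum>x\<leftarrow>ls n. ln (cmod (of_real x - E))) = ln (cmod (Determinant.det (shifted E n)))" for n
  proof -
    have "cmod (\<Prod>x\<leftarrow>xs. E - of_real x) = (\<Prod>x\<leftarrow>xs. cmod (of_real x - E))" for xs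
      by (induction xs) (simp_all add: norm_mult norm_minus_commute)
    then show ?thesis using ne by (simp add: det ln_prod_list)
  qed
  ultimately show ?thesis by simp
qed

lemma exterior_power_norm_tendsto:
  assumes E: "Im E \<noteq> 0"
    and lim: "(\<lambda>n. ln (cmod (Determinant.det (shifted E n))) / real n) \<longlonglongrightarrow> L"
  shows "(\<lambda>n. ln (exterior_power_norm r (transfer_prod E n)) / real n) \<longlonglongrightarrow> L"
proof -
  let ?d = "\<lambda>n. cmod (Determinant.det (shifted E n))"
  let ?S = "{I. I \<subseteq> {..<2 * r} \<and> card I = r}"
  let ?e = "\<lambda>n. exterior_power_norm r (transfer_prod E n)"
  define K0 where "K0 = fact (2 * r) * boundary_bound E ^ (2 * r)"
  define K where "K = real (card ?S) * (real (card ?S) * K0)"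
  have d0: "?d n > 0" for n using det_shifted_nonzero[OF E] by simp
  have fin: "finite ?S" by simp
  have e: "?e n = l2_operator_norm ?S ?S (exterior_power_entry (transfer_prod E n))" for n
    using transfer_prod_carrier[of E n] by (simp add: exterior_power_norm_def del: transfer_prod_carrier)
  have le: "cmod (exterior_power_entry (transfer_prod E n) I J) \<le> K0 * ?d n" if "I \<in> ?S" "J \<in> ?S" for n I J
    unfolding exterior_power_entry_def K0_def using that by (intro cmod_minor_le[OF E]) auto
  have up: "?e n \<le> K * ?d n" for n
    using l2_operator_norm_bounds(1)[OF fin fin, of "exterior_power_entry (transfer_prod E n)", OF le] by (simp add: e K_def mult_ac)
  have top: "{r..<2 * r} \<in> ?S" by auto
  have low: "?d n \<le> ?e n" for n
    using l2_operator_norm_bounds(2)[OF fin fin, of "exterior_power_entry (transfer_prod E n)", OF le top top]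
    by (simp add: e exterior_power_entry_def cmod_corner_minor[OF E])
  \<comment> \<open>Comparing the upper and lower bounds at \<open>n = 0\<close> gives positivity,
    so that ln K is a genuine additive error; division by \<open>n\<close> removes it.\<close>
  have K: "K > 0"
    using up[of 0] low[of 0] d0[of 0] by (meson order_less_le_trans zero_less_mult_pos2)
  have e0: "?e n > 0" for n using low d0 by (rule less_le_trans[rotated])
  have "(\<lambda>n. ln (?e n) / real n - ln (?d n) / real n) \<longlonglongrightarrow> 0"
  proof (rule Lim_null_comparison)
    show "\<forall>\<^sub>F n in sequentially. norm (ln (?e n) / real n - ln (?d n) / real n) \<le> ln K / real n"
    proof (rule always_eventually, rule allI)
      fix n
      have "ln (?d n) \<le> ln (?e n)" using low[of n] d0[of n] e0[of n] by simp
      moreover have "ln (?e n) \<le> ln K + ln (?d n)"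
        unfolding ln_mult_pos[OF K d0, symmetric] by (rule ln_mono[OF up e0])
      ultimately have "\<bar>ln (?e n) - ln (?d n)\<bar> \<le> ln K" by linarith
      then show "norm (ln (?e n) / real n - ln (?d n) / real n) \<le> ln K / real n"
        by (simp add: abs_divide divide_right_mono flip: diff_divide_distrib)
    qed
    show "(\<lambda>n. ln K / real n) \<longlonglongrightarrow> 0" by (rule lim_const_over_n)
  qed
  from tendsto_add[OF this lim] show ?thesis by simp
qed

end

section \<open>Averages of spectral measures\<close>

text \<open>A \<open>measure_of\<close> takes the prescribed values only once they are known to be
  countably additive, and is zero otherwise; hence additivity of the averaged set function is
  checked here.\<close>

lemma
  fixes \<sigma> :: "'v \<Rightarrow> real measure"
  assumes S: "finite S" and sets: "\<And>v. v \<in> S \<Longrightarrow> sets (\<sigma> v) = sets borel"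
  shows sets_average_measure: "sets (average_measure S \<sigma>) = sets borel"
    and space_average_measure: "space (average_measure S \<sigma>) = UNIV"
    and emeasure_average_measure: "X \<in> sets borel \<Longrightarrow>
      emeasure (average_measure S \<sigma>) X = (\<Sum>v\<in>S. emeasure (\<sigma> v) X) / of_nat (card S)"
proof -
  have sa: "sigma_algebra (UNIV :: real set) (sets borel)"
    using sets.sigma_algebra_axioms[of "borel :: real measure"] by simp
  show 1: "sets (average_measure S \<sigma>) = sets borel"
    unfolding average_measure_def using sigma_algebra.sets_measure_of_eq[OF sa] by simp
  show "space (average_measure S \<sigma>) = UNIV"
    using sets_eq_imp_space_eq[OF 1] by simp
  assume X: "X \<in> sets borel"
  show "emeasure (average_measure S \<sigma>) X = (\<Sum>v\<in>S. emeasure (\<sigma> v) X) / of_nat (card S)"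
  proof (rule emeasure_measure_of[OF average_measure_def])
    show "countably_additive (sets (average_measure S \<sigma>)) (\<lambda>X. (\<Sum>v\<in>S. emeasure (\<sigma> v) X) / of_nat (card S))"
      unfolding countably_additive_def 1
    proof (intro allI impI)
      fix A :: "nat \<Rightarrow> real set"
      assume A: "range A \<subseteq> sets borel" "disjoint_family A"
      have "(\<Sum>i. \<Sum>v\<in>S. emeasure (\<sigma> v) (A i)) = (\<Sum>v\<in>S. \<Sum>i. emeasure (\<sigma> v) (A i))"
        by (rule suminf_sum) simp
      also have "\<dots> = (\<Sum>v\<in>S. emeasure (\<sigma> v) (\<Union>i. A i))"
        using A sets by (intro sum.cong suminf_emeasure) auto
      finally show "(\<Sum>i. (\<Sum>v\<in>S. emeasure (\<sigma> v) (A i)) / of_nat (card S))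
          = (\<Sum>v\<in>S. emeasure (\<sigma> v) (\<Union>i. A i)) / of_nat (card S)" by simp
    qed
  qed (use X 1 in \<open>auto simp: positive_def\<close>)
qed

lemma nn_integral_average_measure:
  fixes \<sigma> :: "'v \<Rightarrow> real measure" and u :: "real \<Rightarrow> ennreal"
  assumes S: "finite S" and sets: "\<And>v. v \<in> S \<Longrightarrow> sets (\<sigma> v) = sets borel"
    and u: "u \<in> borel_measurable borel"
  shows "(\<integral>\<^sup>+x. u x \<partial>average_measure S \<sigma>) = (\<Sum>v\<in>S. \<integral>\<^sup>+x. u x \<partial>\<sigma> v) / of_nat (card S)"
  using u
proof (induction rule: borel_measurable_induct)
  case (cong f g)
  then have "f = g" by auto
  then show ?case using cong by simp
next
  case (set A)
  have "(\<integral>\<^sup>+x. indicator A x \<partial>\<sigma> v) = emeasure (\<sigma> v) A" if "v \<in> S" for v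
    using set sets[OF that] by (intro nn_integral_indicator) simp
  moreover have "(\<integral>\<^sup>+x. indicator A x \<partial>average_measure S \<sigma>) = emeasure (average_measure S \<sigma>) A"
    using set sets_average_measure[OF S sets] by (intro nn_integral_indicator) simp
  ultimately show ?case using set by (simp add: emeasure_average_measure[OF S sets])
next
  case (mult u c)
  have m: "u \<in> borel_measurable (\<sigma> v)" if "v \<in> S" for v
    using mult(2) sets[OF that] by (simp cong: measurable_cong_sets)
  have m': "u \<in> borel_measurable (average_measure S \<sigma>)"
    using mult(2) sets_average_measure[OF S sets] by (simp cong: measurable_cong_sets)
  have "(\<Sum>v\<in>S. \<integral>\<^sup>+x. c * u x \<partial>\<sigma> v) = c * (\<Sum>v\<in>S. \<integral>\<^sup>+x. u x \<partial>\<sigma> v)"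
    unfolding sum_distrib_left by (intro sum.cong) (auto simp: nn_integral_cmult m)
  then show ?case using mult by (simp add: nn_integral_cmult m' ennreal_times_divide)
next
  case (add u w)
  have m: "u \<in> borel_measurable (\<sigma> v)" "w \<in> borel_measurable (\<sigma> v)" if "v \<in> S" for v
    using add sets[OF that] by (simp_all cong: measurable_cong_sets)
  have m': "u \<in> borel_measurable (average_measure S \<sigma>)" "w \<in> borel_measurable (average_measure S \<sigma>)"
    using add sets_average_measure[OF S sets] by (simp_all cong: measurable_cong_sets)
  have "(\<Sum>v\<in>S. \<integral>\<^sup>+x. w x + u x \<partial>\<sigma> v) = (\<Sum>v\<in>S. \<integral>\<^sup>+x. w x \<partial>\<sigma> v) + (\<Sum>v\<in>S. \<integral>\<^sup>+x. u x \<partial>\<sigma> v)"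
    unfolding sum.distrib[symmetric] by (intro sum.cong) (auto simp: nn_integral_add m)
  then show ?case using add by (simp add: nn_integral_add m' add_divide_distrib_ennreal)
next
  case (seq U)
  have m: "U i \<in> borel_measurable (\<sigma> v)" if "v \<in> S" for v i
    using seq(1) sets[OF that] by (simp cong: measurable_cong_sets)
  have m': "U i \<in> borel_measurable (average_measure S \<sigma>)" for i
    using seq(1) sets_average_measure[OF S sets] by (simp cong: measurable_cong_sets)
  have lim: "(\<lambda>i. \<integral>\<^sup>+x. U i x \<partial>M) \<longlonglongrightarrow> (\<integral>\<^sup>+x. (SUP i. U i) x \<partial>M)"
    if "\<And>i. U i \<in> borel_measurable M" for M :: "real measure"
  proof -
    have "incseq (\<lambda>i. \<integral>\<^sup>+x. U i x \<partial>M)"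
      using seq by (auto simp: incseq_def le_fun_def intro!: nn_integral_mono)
    from LIMSEQ_SUP[OF this] show ?thesis
      using nn_integral_monotone_convergence_SUP[of U M] that seq by (simp add: image_comp SUP_apply)
  qed
  have "(\<lambda>i. \<integral>\<^sup>+x. U i x \<partial>average_measure S \<sigma>) \<longlonglongrightarrow> (\<Sum>v\<in>S. \<integral>\<^sup>+x. (SUP i. U i) x \<partial>\<sigma> v) / of_nat (card S)"
  \<comment> \<open>For empty \<open>S\<close> the quotient is the product of 0 and infinity in
    \<open>ennreal\<close>, where multiplication is not continuous; there both sides are compared
    directly.\<close>
  proof (cases "S = {}")
    case False
    then have "of_nat (card S) \<noteq> (0 :: ennreal)" using S by simp
    then show ?thesis unfolding seq.IH divide_ennreal_def
      by (intro tendsto_mult_ennreal tendsto_sum lim m tendsto_const) auto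
  qed (use seq.IH in simp)
  from LIMSEQ_unique[OF lim[OF m'] this] show ?case .
qed

text \<open>The identity for nonnegative integrands is applied to the positive and negative parts.
  Integrability with respect to each measure keeps both parts finite, so that they can be subtracted
  as reals.\<close>

lemma average_measure_integral:
  fixes \<sigma> :: "'v \<Rightarrow> real measure" and g :: "real \<Rightarrow> real"
  assumes S: "finite S" "S \<noteq> {}" and sets: "\<And>v. v \<in> S \<Longrightarrow> sets (\<sigma> v) = sets borel"
    and int: "\<And>v. v \<in> S \<Longrightarrow> integrable (\<sigma> v) g" and g: "g \<in> borel_measurable borel"
  shows "integrable (average_measure S \<sigma>) g"
    and "(\<integral>x. g x \<partial>average_measure S \<sigma>) = (\<Sum>v\<in>S. \<integral>x. g x \<partial>\<sigma> v) / real (card S)"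
proof -
  have c0: "real (card S) > 0" using S by (simp add: card_gt_0_iff)
  have nn: "(\<integral>\<^sup>+x. ennreal (u x) \<partial>average_measure S \<sigma>) = ennreal ((\<Sum>v\<in>S. enn2real (\<integral>\<^sup>+x. ennreal (u x) \<partial>\<sigma> v)) / real (card S))"
    if "\<And>v. v \<in> S \<Longrightarrow> (\<integral>\<^sup>+x. ennreal (u x) \<partial>\<sigma> v) < \<infinity>" "u \<in> borel_measurable borel" for u :: "real \<Rightarrow> real"
  proof -
    have "(\<Sum>v\<in>S. \<integral>\<^sup>+x. ennreal (u x) \<partial>\<sigma> v) = (\<Sum>v\<in>S. ennreal (enn2real (\<integral>\<^sup>+x. ennreal (u x) \<partial>\<sigma> v)))"
      using that by (intro sum.cong) (auto simp: less_top)
    also have "\<dots> = ennreal (\<Sum>v\<in>S. enn2real (\<integral>\<^sup>+x. ennreal (u x) \<partial>\<sigma> v))"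
      by (rule sum_ennreal) simp
    finally show ?thesis using c0 that(2)
      by (simp add: nn_integral_average_measure[OF S(1) sets] ennreal_of_nat_eq_real_of_nat
          divide_ennreal sum_nonneg)
  qed
  have fin: "(\<integral>\<^sup>+x. ennreal (norm (g x)) \<partial>\<sigma> v) < \<infinity>" if "v \<in> S" for v
    using int[OF that] by (simp add: integrable_iff_bounded)
  have fin': "(\<integral>\<^sup>+x. ennreal (s * g x) \<partial>\<sigma> v) < \<infinity>" if "v \<in> S" "\<bar>s\<bar> = 1" for v s
  proof -
    have "s * g x \<le> norm (g x)" for x
      using abs_ge_self[of "s * g x"] that by (simp add: abs_mult)
    then have "(\<integral>\<^sup>+x. ennreal (s * g x) \<partial>\<sigma> v) \<le> (\<integral>\<^sup>+x. ennreal (norm (g x)) \<partial>\<sigma> v)"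
      by (intro nn_integral_mono ennreal_leI) auto
    then show ?thesis using fin[OF that(1)] by (rule le_less_trans)
  qed
  have gm: "g \<in> borel_measurable (average_measure S \<sigma>)"
    using g sets_average_measure[OF S(1) sets] by (simp cong: measurable_cong_sets)
  show I: "integrable (average_measure S \<sigma>) g"
    unfolding integrable_iff_bounded using gm nn[of "\<lambda>x. norm (g x)"] fin g by simp
  have p: "(\<integral>\<^sup>+x. ennreal (g x) \<partial>average_measure S \<sigma>)
      = ennreal ((\<Sum>v\<in>S. enn2real (\<integral>\<^sup>+x. ennreal (g x) \<partial>\<sigma> v)) / real (card S))"
    using nn[of g] fin'[of _ 1] g by simp
  have n: "(\<integral>\<^sup>+x. ennreal (- g x) \<partial>average_measure S \<sigma>)
      = ennreal ((\<Sum>v\<in>S. enn2real (\<integral>\<^sup>+x. ennreal (- g x) \<partial>\<sigma> v)) / real (card S))"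
    using nn[of "\<lambda>x. - g x"] fin'[of _ "-1"] g by simp
  show "(\<integral>x. g x \<partial>average_measure S \<sigma>) = (\<Sum>v\<in>S. \<integral>x. g x \<partial>\<sigma> v) / real (card S)"
    unfolding real_lebesgue_integral_def[OF I] p n using c0
    by (simp add: real_lebesgue_integral_def[OF int] sum_nonneg sum_subtractf diff_divide_distrib)
qed

lemma AE_average_measure:
  fixes \<sigma> :: "'v \<Rightarrow> real measure"
  assumes S: "finite S" and sets: "\<And>v. v \<in> S \<Longrightarrow> sets (\<sigma> v) = sets borel"
    and AE: "\<And>v. v \<in> S \<Longrightarrow> AE x in \<sigma> v. \<bar>x\<bar> \<le> K"
  shows "AE x in average_measure S \<sigma>. \<bar>x\<bar> \<le> K"
proof -
  have b: "{x :: real. \<not> \<bar>x\<bar> \<le> K} \<in> sets borel" by measurable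
  have "emeasure (\<sigma> v) {x. \<not> \<bar>x\<bar> \<le> K} = 0" if "v \<in> S" for v
  proof -
    have "space (\<sigma> v) = UNIV" using sets_eq_imp_space_eq[OF sets[OF that]] by simp
    then show ?thesis using AE[OF that] b sets[OF that] by (simp add: AE_iff_measurable[OF _ refl])
  qed
  then have "emeasure (average_measure S \<sigma>) {x. \<not> \<bar>x\<bar> \<le> K} = 0"
    by (simp add: emeasure_average_measure[OF S sets b])
  then show ?thesis
    using b by (subst AE_iff_measurable[OF _ refl])
      (simp_all add: sets_average_measure[OF S sets] space_average_measure[OF S sets])
qed

section \<open>Moments and support of spectral measures\<close>

lemma poly_op_monom: "poly_op (Polynomial.monom 1 k) A = ((\<lambda>B. A o\<^sub>L B) ^^ k) id_blinfun"
proof -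
  have "poly_op (Polynomial.monom 1 k) A = (\<Sum>i\<le>k. if i = k then ((\<lambda>B. A o\<^sub>L B) ^^ i) id_blinfun else 0)"
    unfolding poly_op_def by (intro sum.cong) (auto simp: degree_monom_eq)
  then show ?thesis by simp
qed

lemma blinfun_compose_funpow_apply:
  fixes A :: "'a :: real_normed_vector \<Rightarrow>\<^sub>L 'a"
  shows "blinfun_apply (((\<lambda>B. A o\<^sub>L B) ^^ k) id_blinfun) \<phi> = (blinfun_apply A ^^ k) \<phi>"
  by (induction k) simp_all

lemma ell2_cinner_delta: "ell2_cinner (ell2_delta v) \<psi> = ell2_apply \<psi> v"
proof -
  have "ell2_cinner (ell2_delta v) \<psi> = (\<Sum>\<^sub>\<infinity>w\<in>{v}. cnj (ell2_apply (ell2_delta v) w) * ell2_apply \<psi> w)"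
    unfolding ell2_cinner_def by (rule infsum_cong_neutral) (auto simp: ell2_delta.rep_eq)
  then show ?thesis by (simp add: ell2_delta.rep_eq)
qed

lemma continuous_calculus_poly:
  "continuous_calculus A (poly p) (poly_op p A)"
  unfolding continuous_calculus_def
  by (rule exI[of _ "\<lambda>_. p"]) (auto intro: uniform_limit_const)

text \<open>A constant sequence of polynomials witnesses that the \<open>k\<close>-th power of
  \<open>A\<close> is its image under the calculus of the monomial; pairing with
  \<open>ell2_delta v\<close> reads off a diagonal entry.\<close>

lemma spectral_measure_moment:
  assumes "is_spectral_measure A v \<mu>"
  shows "integrable \<mu> (\<lambda>x. x ^ k)"
    and "ell2_apply ((blinfun_apply A ^^ k) (ell2_delta v)) v = of_real (\<integral>x. x ^ k \<partial>\<mu>)"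
proof -
  have p: "poly (Polynomial.monom 1 k) = (\<lambda>x :: real. x ^ k)" by (auto simp: poly_monom)
  have "continuous_on UNIV (\<lambda>x :: real. x ^ k)" by (intro continuous_intros)
  with assms continuous_calculus_poly[of A "Polynomial.monom 1 k", unfolded p]
  have *: "integrable \<mu> (\<lambda>x. x ^ k) \<and> ell2_cinner (ell2_delta v)
      (blinfun_apply (poly_op (Polynomial.monom 1 k) A) (ell2_delta v)) = of_real (\<integral>x. x ^ k \<partial>\<mu>)"
    unfolding is_spectral_measure_def by blast
  then show "integrable \<mu> (\<lambda>x. x ^ k)" by simp
  show "ell2_apply ((blinfun_apply A ^^ k) (ell2_delta v)) v = of_real (\<integral>x. x ^ k \<partial>\<mu>)"
    using * by (simp add: ell2_cinner_delta poly_op_monom blinfun_compose_funpow_apply)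
qed

text \<open>Continuous functions vanishing on \<open>{- norm A..norm A}\<close> are mapped to \<open>0\<close> by the calculus.\<close>

lemma spectral_measure_support:
  assumes \<mu>: "is_spectral_measure A v \<mu>"
  shows "AE x in \<mu>. \<bar>x\<bar> \<le> norm A"
proof -
  define g where "g x = max 0 (\<bar>x\<bar> - norm A)" for x :: real
  have g: "continuous_on UNIV g" unfolding g_def by (intro continuous_intros)
  have "uniform_limit {- norm A..norm A} (\<lambda>n. poly 0) g sequentially"
  proof (rule uniform_limit_cong[THEN iffD1, OF _ _ uniform_limit_const])
    show "\<forall>\<^sub>F n in sequentially. \<forall>x\<in>{- norm A..norm A}. 0 = poly 0 x" by simp
    show "0 = g x" if "x \<in> {- norm A..norm A}" for x using that by (auto simp: g_def)
  qed
  then have "continuous_calculus A g 0"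
    unfolding continuous_calculus_def by (intro exI[of _ "\<lambda>_. 0"]) (auto simp: poly_op_def)
  with \<mu> g have "integrable \<mu> g \<and>
      ell2_cinner (ell2_delta v) (blinfun_apply 0 (ell2_delta v)) = of_real (\<integral>x. g x \<partial>\<mu>)"
    unfolding is_spectral_measure_def by blast
  then have "integrable \<mu> g" "(\<integral>x. g x \<partial>\<mu>) = 0"
    by (auto simp: ell2_cinner_delta zero_ell2.rep_eq)
  then have "AE x in \<mu>. g x = 0"
    by (subst (asm) integral_nonneg_eq_0_iff_AE) (auto simp: g_def)
  then show ?thesis by eventually_elim (auto simp: g_def)
qed

section \<open>Shifts of the integers and orbits\<close>

text \<open>An order automorphism of the integers preserves immediate successors, hence is
  determined by its value at 0.\<close>

lemma mono_int_bij_shift: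
  fixes g :: "int \<Rightarrow> int"
  assumes surj: "surj g" and mono: "\<And>m n. g m \<le> g n \<longleftrightarrow> m \<le> n"
  shows "g n = n + g 0"
proof -
  have step: "g (n + 1) = g n + 1" for n
  proof -
    obtain m where m: "g m = g n + 1" using surj by (metis surjD)
    have "n + 1 \<le> m" using mono[of m n] m by linarith
    then have "g (n + 1) \<le> g n + 1" using mono[of "n + 1" m] m by simp
    moreover have "g n < g (n + 1)" using mono[of "n + 1" n] by linarith
    ultimately show ?thesis by linarith
  qed
  show ?thesis
  proof (induction n rule: int_induct[where k = 0])
    case (step2 i)
    then show ?case using step[of "i - 1"] by simp
  qed (simp_all add: step)
qed

lemma int_iterate_shift:
  fixes e :: "int \<Rightarrow> 'v"
  assumes F: "bij F" and shift: "\<And>n. F (e n) = e (n + d)"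
  shows "int_iterate F k (e n) = e (n + k * d)"
proof -
  have pos: "(F ^^ j) (e n) = e (n + int j * d)" for j n
    by (induction j) (simp_all add: shift algebra_simps)
  have inv: "inv_into UNIV F (e n) = e (n - d)" for n
    using shift[of "n - d"] bij_is_inj[OF F] by (metis diff_add_cancel inv_f_f)
  have neg: "(inv_into UNIV F ^^ j) (e n) = e (n - int j * d)" for j n
    by (induction j) (simp_all add: inv algebra_simps)
  show ?thesis by (simp add: int_iterate_def pos neg)
qed

text \<open>Instantiated both for \<open>f\<close> and for its \<open>p\<close>-th iterate. Orbits
  become residue classes modulo \<open>d\<close>.\<close>

locale int_shift =
  fixes F :: "'v \<Rightarrow> 'v" and e :: "int \<Rightarrow> 'v" and d :: nat
  assumes bij_F: "bij F" and bij_e: "bij e" and d_pos: "0 < d"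
    and shift: "F (e n) = e (n + int d)"
begin

definition orbit :: "int \<Rightarrow> 'v set" where
  "orbit n = range (\<lambda>k. e (n + k * int d))"

lemma orbit_eq_iff: "orbit m = orbit n \<longleftrightarrow> m mod int d = n mod int d"
proof
  assume "orbit m = orbit n"
  moreover have "e m \<in> orbit m" unfolding orbit_def by (rule range_eqI[of _ _ 0]) simp
  ultimately obtain k where "e m = e (n + k * int d)" by (auto simp: orbit_def)
  then have "m = n + k * int d" using bij_is_inj[OF bij_e] by (auto dest: injD)
  then show "m mod int d = n mod int d" by simp
next
  have sub: "orbit m \<subseteq> orbit n" if "m mod int d = n mod int d" for m n
  proof -
    have "int d dvd m - n" using that by (simp add: mod_eq_dvd_iff)
    then obtain j where "m - n = int d * j" by (rule dvdE)
    then have j: "m = n + j * int d" by (simp add: algebra_simps)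
    show ?thesis
    proof
      fix v assume "v \<in> orbit m"
      then obtain k where "v = e (n + (j + k) * int d)" by (auto simp: orbit_def j algebra_simps)
      then show "v \<in> orbit n" unfolding orbit_def by blast
    qed
  qed
  assume "m mod int d = n mod int d"
  then show "orbit m = orbit n" using sub[of m n] sub[of n m] by auto
qed

lemma mem_orbit: "e n \<in> orbit n"
  unfolding orbit_def by (rule range_eqI[of _ _ 0]) simp

lemma orbit_inj: "inj_on (\<lambda>i. orbit (int i)) {..<d}"
  by (rule inj_onI) (auto simp: orbit_eq_iff)

lemma int_orbits_eq: "int_orbits F = (\<lambda>i. orbit (int i)) ` {..<d}"
proof -
  have "int_orbits F = range orbit"
  proof -
    have "range (\<lambda>k. int_iterate F k (e n)) = orbit n" for n
      unfolding orbit_def using int_iterate_shift[of F e "int d", OF bij_F shift] by simp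
    then have "(\<lambda>v. range (\<lambda>k. int_iterate F k v)) ` range e = range orbit"
      by (simp only: image_image)
    then show ?thesis unfolding int_orbits_def bij_is_surj[OF bij_e] .
  qed
  also have "\<dots> = (\<lambda>i. orbit (int i)) ` {..<d}"
  proof
    show "range orbit \<subseteq> (\<lambda>i. orbit (int i)) ` {..<d}"
    proof
      fix Q assume "Q \<in> range orbit"
      then obtain n where "Q = orbit n" by auto
      moreover have "orbit n = orbit (int (nat (n mod int d)))"
        using d_pos by (simp add: orbit_eq_iff)
      moreover have "nat (n mod int d) < d" using d_pos by (simp add: nat_less_iff)
      ultimately show "Q \<in> (\<lambda>i. orbit (int i)) ` {..<d}"
        by (intro image_eqI[of _ _ "nat (n mod int d)"]) (simp_all only: lessThan_iff)
    qed
  qed auto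
  finally show ?thesis .
qed

text \<open>This identifies the translation length with the dimension parameter of the growth
  rate.\<close>

lemma card_int_orbits: "card (int_orbits F) = d"
  unfolding int_orbits_eq by (simp add: card_image[OF orbit_inj])

lemma orbit_representatives_bij:
  assumes S: "orbit_representatives F S"
  obtains \<rho> where "bij_betw \<rho> {..<d} S" "\<And>i. i < d \<Longrightarrow> \<rho> i \<in> orbit (int i)"
proof -
  have ex: "\<exists>!v. v \<in> S \<inter> orbit (int i)" if "i < d" for i
    using S that unfolding orbit_representatives_def int_orbits_eq by auto
  define \<rho> where "\<rho> i = (THE v. v \<in> S \<inter> orbit (int i))" for i
  have \<rho>: "\<rho> i \<in> S \<inter> orbit (int i)" if "i < d" for i
    unfolding \<rho>_def by (rule theI'[OF ex[OF that]])
  have disj: "i = j" if v: "v \<in> orbit (int i)" "v \<in> orbit (int j)" and ij: "i < d" "j < d" for v i j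
  proof -
    from v obtain a b where "e (int i + a * int d) = e (int j + b * int d)"
      unfolding orbit_def by auto
    then have "int i + a * int d = int j + b * int d"
      using bij_is_inj[OF bij_e] by (auto dest: injD)
    then have "(int i + a * int d) mod int d = (int j + b * int d) mod int d" by simp
    then show ?thesis using ij by simp
  qed
  have "bij_betw \<rho> {..<d} S"
    unfolding bij_betw_def
  proof
    show "inj_on \<rho> {..<d}"
    proof (rule inj_onI)
      fix i j assume ij: "i \<in> {..<d}" "j \<in> {..<d}" "\<rho> i = \<rho> j"
      then have "\<rho> i \<in> orbit (int i)" "\<rho> i \<in> orbit (int j)"
        using \<rho>[of i] \<rho>[of j] by auto
      then show "i = j" using ij by (auto intro: disj)
    qed
    show "\<rho> ` {..<d} = S"
    proof
      show "S \<subseteq> \<rho> ` {..<d}"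
      proof
        fix v assume v: "v \<in> S"
        obtain n where n: "v = e n" using bij_is_surj[OF bij_e] by (metis surjD)
        have "orbit n \<in> int_orbits F" unfolding int_orbits_eq
          using d_pos by (intro image_eqI[of _ _ "nat (n mod int d)"]) (simp_all add: orbit_eq_iff nat_less_iff)
        then obtain i where i: "i < d" "orbit n = orbit (int i)" unfolding int_orbits_eq by auto
        have "v \<in> S \<inter> orbit (int i)" using v n mem_orbit[of n] i by simp
        then have "v = \<rho> i" using ex[OF i(1)] \<rho>[OF i(1)] by blast
        then show "v \<in> \<rho> ` {..<d}" using i by auto
      qed
    qed (use \<rho> in auto)
  qed
  with \<rho> show thesis using that by blast
qed

text \<open>A function constant on orbits does not see which representatives were chosen, so they
  may be replaced by the sites 0 to \<open>d - 1\<close>.\<close>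

lemma orbit_representatives_sum:
  fixes \<phi> :: "'v \<Rightarrow> 'a :: comm_monoid_add"
  assumes S: "orbit_representatives F S" and \<phi>: "\<And>n. \<phi> (e (n + int d)) = \<phi> (e n)"
  shows "(\<Sum>v\<in>S. \<phi> v) = (\<Sum>i<d. \<phi> (e (int i)))" and "finite S" and "card S = d"
proof -
  obtain \<rho> where bij: "bij_betw \<rho> {..<d} S" and \<rho>: "\<And>i. i < d \<Longrightarrow> \<rho> i \<in> orbit (int i)"
    using orbit_representatives_bij[OF S] by blast
  have inv: "\<phi> (e (n + k * int d)) = \<phi> (e n)" for n k
  proof (induction k rule: int_induct[where k = 0])
    case (step1 i)
    then show ?case using \<phi>[of "n + i * int d"] by (simp add: algebra_simps)
  next
    case (step2 i)
    then show ?case using \<phi>[of "n + (i - 1) * int d"] by (simp add: algebra_simps)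
  qed simp
  have "(\<Sum>v\<in>S. \<phi> v) = (\<Sum>i<d. \<phi> (\<rho> i))"
    by (rule sum.reindex_bij_betw[OF bij, symmetric])
  also have "\<dots> = (\<Sum>i<d. \<phi> (e (int i)))"
  proof (rule sum.cong)
    fix i assume "i \<in> {..<d}"
    then obtain k where "\<rho> i = e (int i + k * int d)" using \<rho>[of i] by (auto simp: orbit_def)
    then show "\<phi> (\<rho> i) = \<phi> (e (int i))" by (simp add: inv)
  qed simp
  finally show "(\<Sum>v\<in>S. \<phi> v) = (\<Sum>i<d. \<phi> (e (int i)))" .
  show "finite S" "card S = d"
    using bij_betw_finite[OF bij] bij_betw_same_card[OF bij] by auto
qed

end

text \<open>Read in the coordinates \<open>e\<close>, the map \<open>f\<close> is an order
  automorphism of the integers that moves points upwards, hence a translation by a positive number,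
  which is the number of orbits. The bounds on neighbours then become the band condition.\<close>

lemma order_identification_shift:
  assumes "order_identification adj f R e"
  shows "int_shift f e (card (int_orbits f))"
    and "adj (e n) (e m) \<Longrightarrow> \<bar>n - m\<bar> \<le> int (card (int_orbits f))"
proof -
  obtain L where propL: "propagating adj f L"
    and be: "bij e" and eL: "\<And>m n. (e m, e n) \<in> L \<longleftrightarrow> m \<le> n"
    using assms unfolding order_identification_def by blast
  have bf: "bij f" using propL by (simp add: propagating_def graph_automorphism_def)
  define g where "g n = inv_into UNIV e (f (e n))" for n
  have eg: "e (g n) = f (e n)" for n
    unfolding g_def by (rule surj_f_inv_f[OF bij_is_surj[OF be]])
  have "surj g"
    unfolding g_def using bij_is_surj[OF bij_comp[OF bij_comp[OF be bf] bij_imp_bij_inv[OF be]]]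
    by (simp add: o_def)
  moreover have "g m \<le> g n \<longleftrightarrow> m \<le> n" for m n
    using propL unfolding eL[symmetric] eg propagating_def by blast
  ultimately have g: "g n = n + g 0" for n by (rule mono_int_bij_shift)
  have "(e 0, f (e 0)) \<in> L" "e 0 \<noteq> f (e 0)" using propL unfolding propagating_def by blast+
  then have "0 \<le> g 0" "g 0 \<noteq> 0" unfolding eg[symmetric] eL by auto
  then have g0: "0 < nat (g 0)" by simp
  interpret sh: int_shift f e "nat (g 0)"
  proof
    show "f (e n) = e (n + int (nat (g 0)))" for n
      using eg[of n] g[of n] g0 by simp
  qed (fact bf be g0)+
  have adj: "\<bar>n - m\<bar> \<le> int (nat (g 0))" if "adj (e n) (e m)" for n m
  proof -
    have "(inv_into UNIV f (e n), e m) \<in> L" "(e m, f (e n)) \<in> L"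
      using propL that unfolding propagating_def by blast+
    moreover have "inv_into UNIV f (e n) = e (n - int (nat (g 0)))"
      using sh.shift[of "n - int (nat (g 0))"] bij_is_inj[OF bf] by (metis diff_add_cancel inv_f_f)
    ultimately show ?thesis unfolding sh.shift by (auto simp: eL)
  qed
  show "int_shift f e (card (int_orbits f))"
    unfolding sh.card_int_orbits by (rule sh.int_shift_axioms)
  show "adj (e n) (e m) \<Longrightarrow> \<bar>n - m\<bar> \<le> int (card (int_orbits f))"
    unfolding sh.card_int_orbits by (rule adj)
qed

text \<open>Needed for the periodicity of \<open>hat_potential\<close>, which contains the
  degree.\<close>

lemma card_neighbours_automorphism:
  assumes "graph_automorphism adj f"
  shows "card {w. adj (f v) w} = card {w. adj v w}"
proof -
  have "bij_betw f {w. adj v w} {w. adj (f v) w}"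
    unfolding bij_betw_def
  proof
    show "inj_on f {w. adj v w}"
      using assms by (auto simp: graph_automorphism_def bij_def intro: inj_on_subset)
    show "f ` {w. adj v w} = {w. adj (f v) w}"
    proof
      show "{w. adj (f v) w} \<subseteq> f ` {w. adj v w}"
      proof
        fix w assume w: "w \<in> {w. adj (f v) w}"
        obtain u where "w = f u" using assms by (metis graph_automorphism_def bij_is_surj surjD)
        then show "w \<in> f ` {w. adj v w}" using w assms by (auto simp: graph_automorphism_def)
      qed
    qed (use assms in \<open>auto simp: graph_automorphism_def\<close>)
  qed
  then show ?thesis by (simp add: bij_betw_same_card)
qed

section \<open>Thouless formula\<close>

lemma periodic_int_bounded:
  fixes g :: "int \<Rightarrow> real"
  assumes per: "\<And>n. g (n + int P) = g n" and P: "0 < P"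
  shows "\<bar>g n\<bar> \<le> (\<Sum>i<P. \<bar>g (int i)\<bar>)"
proof -
  have inv: "g (n + k * int P) = g n" for n k
  proof (induction k rule: int_induct[where k = 0])
    case (step1 i)
    then show ?case using per[of "n + i * int P"] by (simp add: algebra_simps)
  next
    case (step2 i)
    then show ?case using per[of "n + (i - 1) * int P"] by (simp add: algebra_simps)
  qed simp
  have "g n = g (int (nat (n mod int P)))"
    using inv[of "n mod int P" "n div int P"] P by (simp add: add.commute)
  moreover have "nat (n mod int P) < P" using P by (simp add: nat_less_iff)
  then have "\<bar>g (int (nat (n mod int P)))\<bar> \<le> (\<Sum>i<P. \<bar>g (int i)\<bar>)"
    by (intro member_le_sum[of _ "{..<P}" "\<lambda>i. \<bar>g (int i)\<bar>"]) auto
  ultimately show ?thesis by simp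
qed

section \<open>The Schroedinger operator as a band matrix, and the telescoped growth rate\<close>

definition band_coeff :: "('v \<Rightarrow> 'v \<Rightarrow> bool) \<Rightarrow> ('v \<Rightarrow> real) \<Rightarrow> (int \<Rightarrow> 'v) \<Rightarrow> int \<Rightarrow> int \<Rightarrow> real" where
  "band_coeff adj V e a b = (if a = b then hat_potential adj V e a else 0) + of_bool (adj (e a) (e b))"

text \<open>The subtracted values in the sum over neighbours amount to the degree times the value at
  the centre, which \<open>hat_potential\<close> absorbs into the diagonal.\<close>

lemma schrodinger_fun_band_coeff:
  fixes adj :: "'v \<Rightarrow> 'v \<Rightarrow> bool"
  assumes e: "bij e" and band: "\<And>m n. adj (e n) (e m) \<Longrightarrow> \<bar>n - m\<bar> \<le> int r"
  shows "schrodinger_fun adj V \<phi> (e a)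
    = (\<Sum>c\<in>{a - int r..a + int r}. of_real (band_coeff adj V e a c) * \<phi> (e c))"
proof -
  let ?I = "{a - int r..a + int r}"
  have nb: "{w. adj (e a) w} = e ` {c \<in> ?I. adj (e a) (e c)}"
  proof
    show "{w. adj (e a) w} \<subseteq> e ` {c \<in> ?I. adj (e a) (e c)}"
    proof
      fix w assume w: "w \<in> {w. adj (e a) w}"
      obtain c where c: "w = e c" using e by (metis bij_is_surj surjD)
      with w band[of a c] have "c \<in> {c \<in> ?I. adj (e a) (e c)}" by auto
      with c show "w \<in> e ` {c \<in> ?I. adj (e a) (e c)}" by blast
    qed
  qed auto
  have inj: "inj_on e {c \<in> ?I. adj (e a) (e c)}"
    using bij_is_inj[OF e] by (rule inj_on_subset) simp
  have "(\<Sum>w | adj (e a) w. \<phi> w) = (\<Sum>c\<in>{c \<in> ?I. adj (e a) (e c)}. \<phi> (e c))"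
    unfolding nb using sum.reindex[OF inj, of \<phi>] by simp
  also have "\<dots> = (\<Sum>c\<in>?I. of_bool (adj (e a) (e c)) * \<phi> (e c))"
    by (rule sum.mono_neutral_cong_left) auto
  finally have 1: "(\<Sum>w | adj (e a) w. \<phi> w) = (\<Sum>c\<in>?I. of_bool (adj (e a) (e c)) * \<phi> (e c))" .
  have 2: "(\<Sum>c\<in>?I. of_bool (a = c) * (of_real (hat_potential adj V e a) * \<phi> (e c)))
      = of_real (hat_potential adj V e a) * \<phi> (e a)"
    by (intro sum_of_bool_mult) auto
  have "schrodinger_fun adj V \<phi> (e a)
      = of_real (hat_potential adj V e a) * \<phi> (e a) + (\<Sum>w | adj (e a) w. \<phi> w)"
    by (simp add: schrodinger_fun_def hat_potential_def sum_subtractf algebra_simps)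
  also have "\<dots> = (\<Sum>c\<in>?I. of_bool (a = c) * (of_real (hat_potential adj V e a) * \<phi> (e c))
      + of_bool (adj (e a) (e c)) * \<phi> (e c))"
    unfolding 1 2[symmetric] by (rule sum.distrib[symmetric])
  also have "\<dots> = (\<Sum>c\<in>?I. of_real (band_coeff adj V e a c) * \<phi> (e c))"
    by (intro sum.cong) (auto simp: band_coeff_def distrib_right)
  finally show ?thesis .
qed

lemma lyapunov_sum_0: "lyapunov_sum adj V e r E 0 = 0"
  by (simp add: lyapunov_sum_def exterior_power_norm_0)

text \<open>The cancellation is formal and holds for whatever values \<open>lim\<close> gives at
  intermediate orders; only the limit at the top order has to be computed.\<close>

lemma growth_rate_eq_lyapunov_sum:
  "growth_rate adj V f e E
    = lyapunov_sum adj V e (card (int_orbits f)) E (card (int_orbits f))"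
proof -
  have "(\<Sum>k=1..n. lyapunov_exponent adj V e r E k) = lyapunov_sum adj V e r E n" for n r
    by (induction n) (simp_all add: lyapunov_exponent_def lyapunov_sum_0)
  then show ?thesis by (simp add: growth_rate_def)
qed

theorem lemma3p10p3:
  fixes adj :: "'v \<Rightarrow> 'v \<Rightarrow> bool" and V :: "'v \<Rightarrow> real" and f :: "'v \<Rightarrow> 'v" and R :: "'v rel"
    and p :: nat and \<sigma> :: "real measure" and e :: "int \<Rightarrow> 'v" and E :: complex
  assumes "simple_graph adj" and "bounded_degree adj" and "propagating adj f R"
    and "periodic_potential f p V"
    and "is_density_of_states adj V f p \<sigma>"
    and "order_identification adj f R e"
    and "Im E \<noteq> 0"
  shows "has_bochner_integral \<sigma> (\<lambda>x. ln (cmod (of_real x - E))) (growth_rate adj V f e E)"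
proof -
  define r where "r = card (int_orbits f)"
  \<comment> \<open>The translation length of the \<open>p\<close>-th iterate of \<open>f\<close>,
    hence the number of its orbits.\<close>
  define P where "P = p * r"
  have shift: "int_shift f e r" and band: "\<And>m n. adj (e n) (e m) \<Longrightarrow> \<bar>n - m\<bar> \<le> int r"
    unfolding r_def by (fact order_identification_shift[OF assms(6)])+
  interpret s: int_shift f e r by (rule shift)
  have p: "p \<ge> 1" and Vp: "\<And>v. V ((f ^^ p) v) = V v"
    using assms(4) by (auto simp: periodic_potential_def)
  have aut: "graph_automorphism adj f" and fadj: "\<And>v. adj (f v) v"
    using assms(3) by (auto simp: propagating_def)
  have adj_sym: "adj v w \<longleftrightarrow> adj w v" for v w
    using assms(1) by (auto simp: simple_graph_def symp_def)
  have iter: "(f ^^ j) (e n) = e (n + int (j * r))" for j n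
    by (induction j) (simp_all add: s.shift algebra_simps)
  interpret sp: int_shift "f ^^ p" e P
  proof
    show "bij (f ^^ p)" by (rule bij_fn[OF s.bij_F])
    show "(f ^^ p) (e n) = e (n + int P)" for n by (simp add: iter P_def)
    show "0 < P" using p s.d_pos by (simp add: P_def)
  qed (rule s.bij_e)
  have adj_iter: "adj ((f ^^ j) v) ((f ^^ j) w) \<longleftrightarrow> adj v w" for j v w
    using aut by (induction j) (simp_all add: graph_automorphism_def)
  have autp: "graph_automorphism adj (f ^^ p)"
    unfolding graph_automorphism_def using sp.bij_F adj_iter by simp
  define H where "H = hat_potential adj V e"
  have H_per: "H (n + int P) = H n" for n
    unfolding H_def hat_potential_def sp.shift[symmetric]
    by (simp add: Vp card_neighbours_automorphism[OF autp])
  \<comment> \<open>The sum over a period dominates the periodic diagonal; the added 1 accounts for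
    the adjacency entry.\<close>
  define C where "C = (\<Sum>i<P. \<bar>H (int i)\<bar>) + 1"
  define h where "h = band_coeff adj V e"
  interpret b: banded h r P C
  proof
    fix a c :: int
    show "h a c = h c a" by (simp add: h_def band_coeff_def adj_sym)
    show "h a c = 0" if "int r < \<bar>a - c\<bar>"
      using that band[of a c] by (auto simp: h_def band_coeff_def)
    show "h a (a + int r) = 1"
      using fadj[of "e a"] s.d_pos adj_sym by (simp add: h_def band_coeff_def s.shift)
    have "\<bar>H a\<bar> \<le> C - 1"
      using periodic_int_bounded[of H P a, OF H_per sp.d_pos] by (simp add: C_def)
    moreover have "C \<ge> 1" by (simp add: C_def sum_nonneg)
    ultimately show "\<bar>h a c\<bar> \<le> C" by (auto simp: h_def band_coeff_def H_def[symmetric])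
    show "h (a + int P) (c + int P) = h a c"
      unfolding h_def band_coeff_def sp.shift[symmetric]
      using adj_iter[of p "e a" "e c"] by (simp add: H_per[unfolded H_def])
  qed (fact s.d_pos sp.d_pos)+
  have tm: "transfer_matrix adj V e r E n = b.transfer E n" for n
    unfolding transfer_matrix_def b.transfer_def
    by (rule cong_mat) (auto simp: h_def band_coeff_def)
  have tp: "transfer_product adj V e r E n = b.transfer_prod E n" for n
    by (induction n) (simp_all add: tm)
  define A where "A = schrodinger adj V"
  have V_bound: "\<bar>V v\<bar> \<le> (\<Sum>i<P. \<bar>V (e (int i))\<bar>)" for v
  proof -
    obtain n where "v = e n" using s.bij_e by (metis bij_is_surj surjD)
    moreover have "V (e (n + int P)) = V (e n)" for n by (simp add: Vp sp.shift[symmetric])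
    ultimately show ?thesis using periodic_int_bounded[of "\<lambda>n. V (e n)" P n] sp.d_pos by simp
  qed
  have A: "ell2_apply (blinfun_apply A \<phi>) = schrodinger_fun adj V (ell2_apply \<phi>)" for \<phi>
    unfolding A_def by (rule schrodinger_apply[OF assms(1,2) V_bound])
  have sf: "schrodinger_fun adj V \<psi> (e a) = (\<Sum>c\<in>{a - int r..a + int r}. of_real (h a c) * \<psi> (e c))"
    for \<psi> a
    unfolding h_def by (rule schrodinger_fun_band_coeff[OF s.bij_e]) (rule band)
  have A_pow: "ell2_apply ((blinfun_apply A ^^ k) (ell2_delta (e c))) (e a) = of_real (b.band_power k a c)" for k a c
  proof (induction k arbitrary: a)
    case 0
    have "e a = e c \<longleftrightarrow> a = c" using bij_is_inj[OF s.bij_e] by (auto dest: injD)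
    then show ?case by (simp add: ell2_delta.rep_eq)
  next
    case (Suc k)
    have "ell2_apply ((blinfun_apply A ^^ Suc k) (ell2_delta (e c))) (e a)
        = schrodinger_fun adj V (ell2_apply ((blinfun_apply A ^^ k) (ell2_delta (e c)))) (e a)"
      by (simp add: A)
    also have "\<dots> = (\<Sum>c'\<in>{a - int r..a + int r}. of_real (h a c') * of_real (b.band_power k c' c))"
      unfolding sf Suc.IH ..
    finally show ?case by simp
  qed
  obtain S \<sigma>s where S: "orbit_representatives (f ^^ p) S"
    and \<sigma>s: "\<And>v. v \<in> S \<Longrightarrow> is_spectral_measure A v (\<sigma>s v)" and \<sigma>: "\<sigma> = average_measure S \<sigma>s"
    using assms(5) unfolding is_density_of_states_def A_def by blast
  \<comment> \<open>The \<open>k\<close>-th moment of the spectral measure at \<open>v\<close>. It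
    is constant along orbits of the iterate, since \<open>band_power\<close> has period
    \<open>P\<close>, so its sum over \<open>S\<close> is the sum over one period.\<close>
  define \<phi> where "\<phi> k v = Re (ell2_apply ((blinfun_apply A ^^ k) (ell2_delta v)) v)" for k v
  have \<phi>_e: "\<phi> k (e n) = b.band_power k n n" for k n by (simp add: \<phi>_def A_pow)
  note S_sum = sp.orbit_representatives_sum[OF S, of "\<phi> k" for k, unfolded \<phi>_e, OF b.band_power_periodic]
  have S_fin: "finite S" and S_card: "card S = P" using S_sum(2,3) by auto
  have S_ne: "S \<noteq> {}" using S_card sp.d_pos by auto
  have sets_s: "sets (\<sigma>s v) = sets borel" and fin_s: "finite_measure (\<sigma>s v)" if "v \<in> S" for v
    using \<sigma>s[OF that] by (auto simp: is_spectral_measure_def)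
  have moment_s: "(\<integral>x. x ^ k \<partial>\<sigma>s v) = \<phi> k v" if "v \<in> S" for v k
    unfolding \<phi>_def spectral_measure_moment(2)[OF \<sigma>s[OF that]] by simp
  have sets: "sets \<sigma> = sets borel" unfolding \<sigma> by (rule sets_average_measure[OF S_fin sets_s])
  have fin: "finite_measure \<sigma>"
  proof (rule finite_measureI)
    have "(\<Sum>v\<in>S. emeasure (\<sigma>s v) UNIV) \<noteq> \<infinity>"
      using fin_s by (simp add: finite_measure.emeasure_finite S_fin)
    then show "emeasure \<sigma> (space \<sigma>) \<noteq> \<infinity>"
      using S_ne S_fin
      by (simp add: \<sigma> space_average_measure[OF S_fin sets_s] emeasure_average_measure[OF S_fin sets_s]
          ennreal_divide_eq_top_iff)
  qed
  \<comment> \<open>All spectral measures share the bound \<open>norm A\<close>, so it passes to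
    their average and later supplies the compact interval for the moment argument.\<close>
  have AE: "AE x in \<sigma>. \<bar>x\<bar> \<le> norm A"
    unfolding \<sigma> by (intro AE_average_measure S_fin sets_s spectral_measure_support[OF \<sigma>s])
  have moment: "(\<integral>x. x ^ k \<partial>\<sigma>) = b.moment k" for k
  proof -
    have "(\<integral>x. x ^ k \<partial>\<sigma>) = (\<Sum>v\<in>S. \<integral>x. x ^ k \<partial>\<sigma>s v) / real (card S)"
      unfolding \<sigma> by (intro average_measure_integral S_fin S_ne sets_s spectral_measure_moment(1)[OF \<sigma>s]) auto
    also have "\<dots> = (\<Sum>v\<in>S. \<phi> k v) / real P" by (simp add: moment_s S_card)
    finally show ?thesis by (simp add: S_sum(1) b.moment_def)
  qed
  have "(\<lambda>n. ln (exterior_power_norm r (b.transfer_prod E n)) / real n)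
      \<longlonglongrightarrow> (\<integral>x. ln (cmod (of_real x - E)) \<partial>\<sigma>)"
    by (rule b.exterior_power_norm_tendsto[OF assms(7)
          b.log_det_shifted_tendsto[OF assms(7) fin sets AE moment]])
  then have "growth_rate adj V f e E = (\<integral>x. ln (cmod (of_real x - E)) \<partial>\<sigma>)"
    unfolding growth_rate_eq_lyapunov_sum lyapunov_sum_def r_def[symmetric] tp by (rule limI)
  moreover have "integrable \<sigma> (\<lambda>x. ln (cmod (of_real x - E)))"
  proof (rule integrable_continuous_bounded_support[OF fin sets AE])
    have "of_real x - E \<noteq> 0" for x using assms(7) by (auto simp: complex_eq_iff)
    then show "continuous_on UNIV (\<lambda>x. ln (cmod (of_real x - E)))"
      by (intro continuous_intros) auto
  qed
  ultimately show ?thesis by (simp add: has_bochner_integral_iff)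
qed

end
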